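(* Let $S_j$ be local potentials satisfying (A)–(E), let $\omega\in\mathbb{R}^d$, let $x\in\overline{\mathcal{B}}_\omega$ be a global minimizer, let $[y^-,y^+]$ be a gap of the Aubry–Mather set $\mathcal{M}(x)$, and let $\Gamma$ be a ghost circle with $\mathcal{M}(x)\subset\Gamma$. Then either $\Gamma\cap[y^-,y^+]$ consists of global minimizers only, or there is at least one stationary configuration $y\in\Gamma\cap[y^-,y^+]$ that is not a global minimizer.
   Context: Notation: $\|i\|=\sum_{k=1}^d|i_k|$, $B_j^r=\{k:\|k-j\|\le r\}$, $(\tau_{k,l}x)_i=x_{i+k}+l$. Local potentials $S_j:\mathbb{R}^{\mathbb{Z}^d}\to\mathbb{R}$, $j\in\mathbb{Z}^d$, satisfy: (A) there is $r\in(0,\infty)$ and $C^2$ functions $s_j:\mathbb{R}^{B_j^r}\to\mathbb{R}$ with $S_j(x)=s_j(x|_{B_j^r})$; (B) $S_j(\tau_{k,l}x)=S_{j+k}(x)$; (C) each $S_j$ is bounded below and $S_j(x)\to\infty$ as $|x_k-x_j|\to\infty$ whenever $\|k-j\|=1$; (D) $\partial_{i,k}S_j\le0$ for $i\ne k$, and $\partial_{i,k}S_i<0$ when $\|i-k\|=1$; (E) $|\partial_{i,k}S_j|\le C$ uniformly. Order: $x\le y$ iff $x_i\le y_i$ for all $i$; $x\ll y$ iff $x_i<y_i$ for all $i$; $[a,b]=\{z:a\le z\le b\}$. Birkhoff, rotation vector: $\tau_{k,l}x\ge x$ or $\le x$ for all $(k,l)$; $\lim_nx_{ni}/n=\langle\omega,i\rangle$.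 $\overline{\mathcal{B}}_\omega$: Birkhoff configurations of rotation vector $\omega$ with $\tau_{k,l}x=x$ whenever $\langle\omega,k\rangle+l=0$. Stationary: $\sum_{\|j-i\|\le r}\partial_iS_j(x)=0$ for all $i$. Global minimizer: $W_B(x+y)\ge W_B(x)$ for every finite $B$ and every $y$ supported in $\mathring{B}^{(r)}=\{i\in B:B_i^r\subset B\}$, $W_B=\sum_{j\in B}S_j$. $\widetilde{\mathcal{M}}(x)$ is the pointwise closure of $\{\tau_{k,l}x:(k,l)\in\mathbb{Z}^d\times\mathbb{Z}\}$. The Aubry–Mather set $\mathcal{M}(x)$ is $\widetilde{\mathcal{M}}(x)$ if $\omega\in\mathbb{Q}^d$, and if $\omega\notin\mathbb{Q}^d$ it is $\{y\in\widetilde{\mathcal{M}}(x):y=\lim_n\tau_{k_n,l_n}y\text{ pointwise for some }(k_n,l_n)\text{ with }\langle\omega,k_n\rangle+l_n\ne0\}$. A gap of $\mathcal{M}(x)$ is an order interval $[y^-,y^+]$ with $y^-,y^+\in\mathcal{M}(x)$, $y^-\ll y^+$, containing no element of $\mathcal{M}(x)$ other than $y^\pm$. $\mathbb{X}=\{x:\sum_i2^{-\|i\|}|x_i|<\infty\}$; $(\nabla W(x))_i=\sum_{\|j-i\|\le r}\partial_iS_j(x)$; $\Psi_t$ the complete flow of $\dot x=-\nabla W(x)$ on $\mathbb{X}$. A ghost circle is a set $\Gamma$ that is nonempty, closed and connected (pointwise topology), strictly ordered (for $x,y\in\Gamma$: $x\ll y$, $x=y$ or $y\ll x$), shift-invariant,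 with $\Psi_t(\Gamma)=\Gamma$ for all $t$. *)

theory Defs
  imports "HOL-Analysis.Analysis" "HOL-Library.Function_Algebras"
begin

text \<open>Lattice sites are elements of the type 'd \<Rightarrow> int with 'd a finite type
  (so Z^d with d = CARD('d)); configurations are functions sites \<Rightarrow> real.
  The pointwise topology on configurations is the product topology
  (instance from HOL-Analysis Function_Topology).\<close>

type_synonym 'd site = "'d \<Rightarrow> int"
type_synonym 'd config = "'d site \<Rightarrow> real"

definition l1norm :: "'d::finite site \<Rightarrow> int" where
  "l1norm i = (\<Sum>m\<in>UNIV. \<bar>i m\<bar>)"

definition sball :: "'d::finite site \<Rightarrow> real \<Rightarrow> 'd site set" where
  "sball j r = {k. real_of_int (l1norm (k - j)) \<le> r}"

definition tau :: "'d site \<Rightarrow> int \<Rightarrow> 'd config \<Rightarrow> 'd config" where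
  "tau k l x = (\<lambda>i. x (i + k) + real_of_int l)"

definition ip :: "('d::finite \<Rightarrow> real) \<Rightarrow> 'd site \<Rightarrow> real" where
  "ip \<omega> k = (\<Sum>m\<in>UNIV. \<omega> m * real_of_int (k m))"

definition pd :: "'d site \<Rightarrow> ('d config \<Rightarrow> real) \<Rightarrow> 'd config \<Rightarrow> real" where
  "pd i F x = deriv (\<lambda>t. F (x(i := x i + t))) 0"

definition depends_only_on :: "('d config \<Rightarrow> real) \<Rightarrow> 'd site set \<Rightarrow> bool" where
  "depends_only_on F B \<longleftrightarrow> (\<forall>x y. (\<forall>i\<in>B. x i = y i) \<longrightarrow> F x = F y)"

definition C2_fun :: "('d config \<Rightarrow> real) \<Rightarrow> bool" where
  "C2_fun F \<longleftrightarrow>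
     (\<forall>i x. (\<lambda>t. F (x(i := x i + t))) differentiable (at 0)) \<and>
     (\<forall>i k x. (\<lambda>t. pd i F (x(k := x k + t))) differentiable (at 0)) \<and>
     (\<forall>i k. continuous_on UNIV (pd k (pd i F)))"

definition local_potentials ::
  "('d::finite site \<Rightarrow> 'd config \<Rightarrow> real) \<Rightarrow> real \<Rightarrow> bool" where
  "local_potentials S r \<longleftrightarrow>
     0 < r \<and>
     \<comment> \<open>(A)\<close>
     (\<forall>j. depends_only_on (S j) (sball j r) \<and> C2_fun (S j)) \<and>
     \<comment> \<open>(B)\<close>
     (\<forall>j k l x. S j (tau k l x) = S (j + k) x) \<and>
     \<comment> \<open>(C)\<close>
     (\<forall>j. \<exists>m. \<forall>x. m \<le> S j x) \<and>
     (\<forall>j k. l1norm (k - j) = 1 \<longrightarrow>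
        (\<forall>M. \<exists>R. \<forall>x. R < \<bar>x k - x j\<bar> \<longrightarrow> M < S j x)) \<and>
     \<comment> \<open>(D)\<close>
     (\<forall>i k j x. i \<noteq> k \<longrightarrow> pd k (pd i (S j)) x \<le> 0) \<and>
     (\<forall>i k x. l1norm (i - k) = 1 \<longrightarrow> pd k (pd i (S i)) x < 0) \<and>
     \<comment> \<open>(E)\<close>
     (\<exists>C. \<forall>i k j x. \<bar>pd k (pd i (S j)) x\<bar> \<le> C)"

definition strict_less :: "'d config \<Rightarrow> 'd config \<Rightarrow> bool" where
  "strict_less x y \<longleftrightarrow> (\<forall>i. x i < y i)"

definition birkhoff :: "'d config \<Rightarrow> bool" where
  "birkhoff x \<longleftrightarrow> (\<forall>k l. x \<le> tau k l x \<or> tau k l x \<le> x)"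

definition has_rotation_vector :: "'d::finite config \<Rightarrow> ('d \<Rightarrow> real) \<Rightarrow> bool" where
  "has_rotation_vector x \<omega> \<longleftrightarrow>
     (\<forall>i. (\<lambda>n::nat. x (\<lambda>m. int n * i m) / real n) \<longlonglongrightarrow> ip \<omega> i)"

definition Bbar :: "('d::finite \<Rightarrow> real) \<Rightarrow> 'd config set" where
  "Bbar \<omega> = {x. birkhoff x \<and> has_rotation_vector x \<omega> \<and>
                  (\<forall>k l. ip \<omega> k + real_of_int l = 0 \<longrightarrow> tau k l x = x)}"

definition stationary ::
  "('d::finite site \<Rightarrow> 'd config \<Rightarrow> real) \<Rightarrow> real \<Rightarrow> 'd config \<Rightarrow> bool" where
  "stationary S r x \<longleftrightarrow> (\<forall>i. (\<Sum>j\<in>sball i r. pd i (S j) x) = 0)"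

definition WB :: "('d site \<Rightarrow> 'd config \<Rightarrow> real) \<Rightarrow> 'd site set \<Rightarrow> 'd config \<Rightarrow> real" where
  "WB S B x = (\<Sum>j\<in>B. S j x)"

definition inner_part :: "'d::finite site set \<Rightarrow> real \<Rightarrow> 'd site set" where
  "inner_part B r = {i\<in>B. sball i r \<subseteq> B}"

definition global_minimizer ::
  "('d::finite site \<Rightarrow> 'd config \<Rightarrow> real) \<Rightarrow> real \<Rightarrow> 'd config \<Rightarrow> bool" where
  "global_minimizer S r x \<longleftrightarrow>
     (\<forall>B y. finite B \<longrightarrow> (\<forall>i. i \<notin> inner_part B r \<longrightarrow> y i = 0) \<longrightarrow>
        WB S B x \<le> WB S B (x + y))"

definition Mtilde :: "'d config \<Rightarrow> 'd config set" where
  "Mtilde x = closure {tau k l x | k l. True}"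

definition aubry_mather :: "('d::finite \<Rightarrow> real) \<Rightarrow> 'd config \<Rightarrow> 'd config set" where
  "aubry_mather \<omega> x =
     (if (\<forall>m. \<omega> m \<in> \<rat>) then Mtilde x
      else {y \<in> Mtilde x. \<exists>kn ln. (\<forall>n. ip \<omega> (kn n) + real_of_int (ln n) \<noteq> 0) \<and>
                                 (\<lambda>n. tau (kn n) (ln n) y) \<longlonglongrightarrow> y})"

definition is_gap :: "'d config set \<Rightarrow> 'd config \<Rightarrow> 'd config \<Rightarrow> bool" where
  "is_gap M ym yp \<longleftrightarrow> ym \<in> M \<and> yp \<in> M \<and> strict_less ym yp \<and>
     (\<forall>z\<in>M. ym \<le> z \<and> z \<le> yp \<longrightarrow> z = ym \<or> z = yp)"

definition ord_interval :: "'d config \<Rightarrow> 'd config \<Rightarrow> 'd config set" where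
  "ord_interval a b = {z. a \<le> z \<and> z \<le> b}"

definition weight :: "'d::finite site \<Rightarrow> real" where
  "weight i = 2 powr (- real_of_int (l1norm i))"

definition inX :: "'d::finite config \<Rightarrow> bool" where
  "inX x \<longleftrightarrow> (\<lambda>i. weight i * \<bar>x i\<bar>) summable_on UNIV"

definition Xnorm :: "'d::finite config \<Rightarrow> real" where
  "Xnorm x = (\<Sum>\<^sub>\<infinity>i. weight i * \<bar>x i\<bar>)"

definition gradW ::
  "('d::finite site \<Rightarrow> 'd config \<Rightarrow> real) \<Rightarrow> real \<Rightarrow> 'd config \<Rightarrow> 'd config" where
  "gradW S r x = (\<lambda>i. \<Sum>j\<in>sball i r. pd i (S j) x)"

definition is_solution ::
  "('d::finite site \<Rightarrow> 'd config \<Rightarrow> real) \<Rightarrow> real \<Rightarrow> (real \<Rightarrow> 'd config) \<Rightarrow> bool" where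
  "is_solution S r \<gamma> \<longleftrightarrow>
     (\<forall>t. inX (\<gamma> t)) \<and>
     (\<forall>t. ((\<lambda>h. Xnorm (\<lambda>i. (\<gamma> (t + h) i - \<gamma> t i) / h + gradW S r (\<gamma> t) i))
             \<longlongrightarrow> 0) (at 0))"

definition is_flow ::
  "('d::finite site \<Rightarrow> 'd config \<Rightarrow> real) \<Rightarrow> real \<Rightarrow> (real \<Rightarrow> 'd config \<Rightarrow> 'd config) \<Rightarrow> bool" where
  "is_flow S r \<Psi> \<longleftrightarrow> (\<forall>x. inX x \<longrightarrow> \<Psi> 0 x = x \<and> is_solution S r (\<lambda>t. \<Psi> t x))"

definition ghost_circle ::
  "(real \<Rightarrow> 'd::finite config \<Rightarrow> 'd config) \<Rightarrow> 'd config set \<Rightarrow> bool" where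
  "ghost_circle \<Psi> \<Gamma> \<longleftrightarrow>
     \<Gamma> \<noteq> {} \<and> closed \<Gamma> \<and> connected \<Gamma> \<and>
     (\<forall>x\<in>\<Gamma>. \<forall>y\<in>\<Gamma>. strict_less x y \<or> x = y \<or> strict_less y x) \<and>
     (\<forall>k l. tau k l ` \<Gamma> = \<Gamma>) \<and>
     (\<forall>x\<in>\<Gamma>. inX x) \<and>
     (\<forall>t. \<Psi> t ` \<Gamma> = \<Gamma>)"

end

(*
If y is on \<Gamma> then so is \<Psi> t y, and \<Gamma> is strictly ordered; differentiating at t = 0, all entries of
gradW y have the same sign. Suppose y in the gap is not a minimizer and every stationary point of
\<Gamma> in the gap is. Let z << w be the stationary points of \<Gamma> adjacent to y. On the arc between them
the sign of gradW is constant, so W_B(w) - W_B(z) is, up to boundary terms, a sum over the interior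
sites of B of quantities of one sign, constant and nonzero along the translates of some site by the
periods of z. Minimality of both ends makes this difference a boundary term as well, so the number
of periods in a ball of radius M is at most a multiple of the sum of w - z over a shell of radius M.
Translates of [z, w] by non-periods are disjoint, so conversely the sum of w - z over a ball of
radius N is at most twice the number of periods in the ball of radius 2 N. Summing over shells, the
number of periods would grow faster than any polynomial, which is absurd in Z^d.
*)
theory Submission
  imports Defs
begin

section \<open>Configurations, translations and partial derivatives\<close>

lemma l1norm_triangle: "l1norm (i + j) \<le> l1norm i + l1norm j"
  unfolding l1norm_def plus_fun_def sum.distrib[symmetric] by (intro sum_mono) linarith

lemma l1norm_minus_commute: "l1norm (i - j) = l1norm (j - i)"
  unfolding l1norm_def by (simp add: abs_minus_commute)

lemma sball_sym: "k \<in> sball j r \<longleftrightarrow> j \<in> sball k r"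
  by (simp add: sball_def l1norm_minus_commute)

lemma sball_shift: "k + m \<in> sball (j + m) r \<longleftrightarrow> k \<in> sball j r"
  by (simp add: sball_def)

lemma sball_center: "0 \<le> r \<Longrightarrow> j \<in> sball j r"
  by (simp add: sball_def l1norm_def)

lemma sball_add: "k \<in> sball j s \<Longrightarrow> i \<in> sball k r \<Longrightarrow> i \<in> sball j (s + r)"
  using l1norm_triangle[of "i - k" "k - j"] by (simp add: sball_def)

lemma sball_mono: "s \<le> r \<Longrightarrow> sball j s \<subseteq> sball j r"
  by (auto simp: sball_def)

lemma sball_image: "sball (j + m) r = (\<lambda>k. k + m) ` sball j r"
  by (rule set_eqI) (metis (no_types, lifting) diff_add_cancel image_iff sball_shift)

lemma sball_subset_box:
  fixes j :: "'d::finite site"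
  shows "sball j (real N) \<subseteq> (\<Pi>\<^sub>E m\<in>UNIV. {j m - int N..j m + int N})"
proof
  fix k assume "k \<in> sball j (real N)"
  hence *: "l1norm (k - j) \<le> int N"
    by (simp add: sball_def)
  have "\<bar>k m - j m\<bar> \<le> int N" for m
  proof -
    have "\<bar>k m - j m\<bar> \<le> l1norm (k - j)"
      unfolding l1norm_def using member_le_sum[of m UNIV "\<lambda>m. \<bar>(k - j) m\<bar>"] by simp
    thus ?thesis using * by linarith
  qed
  hence "k m \<in> {j m - int N..j m + int N}" for m
    by (smt (verit) atLeastAtMost_iff)
  thus "k \<in> (\<Pi>\<^sub>E m\<in>UNIV. {j m - int N..j m + int N})" by auto
qed

lemma finite_sball [simp]:
  fixes j :: "'d::finite site"
  shows "finite (sball j r)"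
proof -
  have "sball j r \<subseteq> sball j (real (nat \<lceil>r\<rceil>))" by (intro sball_mono) linarith
  moreover have "finite (sball j (real (nat \<lceil>r\<rceil>)))"
    by (rule finite_subset[OF sball_subset_box]) (intro finite_PiE; simp)
  ultimately show ?thesis by (rule finite_subset)
qed

lemma card_sball_le:
  fixes j :: "'d::finite site"
  shows "card (sball j (real N)) \<le> (2 * N + 1) ^ CARD('d)"
proof -
  have "card (sball j (real N)) \<le> card (\<Pi>\<^sub>E m\<in>UNIV. {j m - int N..j m + int N})"
    by (rule card_mono[OF _ sball_subset_box]) (intro finite_PiE; simp)
  also have "\<dots> = (2 * N + 1) ^ CARD('d)"
    by (subst card_PiE) (auto simp: nat_add_distrib nat_mult_distrib)
  finally show ?thesis .
qed

lemma card_sball: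
  fixes j :: "'d::finite site"
  shows "card (sball j r) = card (sball (0 :: 'd site) r)"
proof -
  have "card (sball j r) = card ((\<lambda>k. k + j) ` sball 0 r)"
    using sball_image[of 0 j r] by (simp only: add_0)
  also have "\<dots> = card (sball (0 :: 'd site) r)"
    by (rule card_image) (simp add: inj_on_def)
  finally show ?thesis .
qed

section \<open>Translations, one-site derivatives and a coordinatewise mean value theorem\<close>

lemma tau_tau: "tau k l (tau k' l' x) = tau (k + k') (l + l') x"
  by (auto simp: tau_def add_ac)

lemma tau_zero [simp]: "tau 0 0 x = x"
  by (simp add: tau_def)

lemma tau_inverse [simp]: "tau (-k) (-l) (tau k l x) = x" "tau k l (tau (-k) (-l) x) = x"
  by (simp_all add: tau_tau)

lemma strict_less_tau [simp]: "strict_less (tau k l x) (tau k l y) \<longleftrightarrow> strict_less x y"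
proof
  assume *: "strict_less (tau k l x) (tau k l y)"
  show "strict_less x y" unfolding strict_less_def
  proof
    fix i show "x i < y i" using *[unfolded strict_less_def, rule_format, of "i - k"] by (simp add: tau_def)
  qed
qed (simp add: strict_less_def tau_def)

lemma tau_update: "(tau k l x)(i := tau k l x i + t) = tau k l (x(i + k := x (i + k) + t))"
  by (auto simp: tau_def fun_eq_iff)

lemma DERIV_pd:
  assumes "\<And>i x. (\<lambda>t. F (x(i := x i + t))) differentiable (at 0)"
  shows "((\<lambda>t. F (x(i := t))) has_real_derivative pd i F (x(i := t))) (at t)"
proof -
  define y where "y = x(i := t)"
  have "((\<lambda>h. F (y(i := y i + h))) has_real_derivative pd i F y) (at 0)"
    using assms[of y i] unfolding pd_def
    by (simp add: DERIV_deriv_iff_real_differentiable)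
  hence "((\<lambda>h. F (x(i := t + h))) has_real_derivative pd i F y) (at 0)"
    by (simp add: y_def)
  thus ?thesis
    using DERIV_shift[of "\<lambda>t. F (x(i := t))" "pd i F y" 0 t] by (simp add: y_def add.commute)
qed

lemma pd_depends_only_on:
  assumes "depends_only_on F B" shows "depends_only_on (pd i F) B"
  unfolding depends_only_on_def
proof (intro allI impI)
  fix x y :: "'a config" assume *: "\<forall>i\<in>B. x i = y i"
  have "F (x(i := x i + t)) = F (y(i := y i + t))" if "i \<in> B" for t
    using assms * that unfolding depends_only_on_def by simp
  moreover have "F (x(i := x i + t)) = F (y(i := y i + t))" if "i \<notin> B" for t
    using assms * that unfolding depends_only_on_def by (metis fun_upd_other)
  ultimately show "pd i F x = pd i F y" unfolding pd_def by (cases "i \<in> B") simp_all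
qed

lemma pd_eq_0:
  assumes "depends_only_on F B" "i \<notin> B" shows "pd i F x = 0"
proof -
  have "F (x(i := x i + t)) = F x" for t
    using assms unfolding depends_only_on_def by (metis fun_upd_other)
  thus ?thesis unfolding pd_def by simp
qed

text \<open>Coordinates are changed one at a time, with the one-variable mean value theorem at each.
  So every site gets its own intermediate configuration, in the box between \<open>u\<close> and
  \<open>v\<close> rather than on the segment joining them.\<close>

lemma mean_value_coordinatewise:
  assumes "finite A"
    and diff: "\<And>i x. (\<lambda>t. F (x(i := x i + t))) differentiable (at 0)"
    and "\<And>k. k \<notin> A \<Longrightarrow> v k = u k"
  shows "\<exists>\<xi>. (\<forall>m k. \<xi> m k \<in> closed_segment (u k) (v k)) \<and>
              F v - F u = (\<Sum>m\<in>A. pd m F (\<xi> m) * (v m - u m))"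
  using assms(1,3)
proof (induction A arbitrary: v rule: finite_induct)
  case empty
  hence "v = u" by auto
  thus ?case by (intro exI[of _ "\<lambda>_. u"]) simp
next
  case (insert a A)
  define v' where "v' = v(a := u a)"
  have out: "v' k = u k" if "k \<notin> A" for k
    using insert.prems that by (cases "k = a") (simp_all add: v'_def)
  obtain \<xi> where \<xi>: "\<And>m k. \<xi> m k \<in> closed_segment (u k) (v' k)"
    "F v' - F u = (\<Sum>m\<in>A. pd m F (\<xi> m) * (v' m - u m))"
    using insert.IH[OF out] by blast
  have seg: "\<xi> m k \<in> closed_segment (u k) (v k)" for m k
    using \<xi>(1)[of m k] by (cases "k = a") (auto simp: v'_def)
  have D: "((\<lambda>t. F (v(a := t))) has_real_derivative pd a F (v(a := t))) (at t)" for t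
    by (rule DERIV_pd[OF diff])
  have "\<exists>t\<in>closed_segment (u a) (v a). F v - F v' = pd a F (v(a := t)) * (v a - u a)"
  proof (cases "u a = v a")
    case True thus ?thesis by (auto simp: v'_def)
  next
    case False
    then obtain t where t: "if u a < v a then u a < t \<and> t < v a else v a < t \<and> t < u a"
      "F (v(a := v a)) - F (v(a := u a)) = (v a - u a) * pd a F (v(a := t))"
      using MVT2[of "u a" "v a" "\<lambda>t. F (v(a := t))" "\<lambda>t. pd a F (v(a := t))"]
            MVT2[of "v a" "u a" "\<lambda>t. F (v(a := t))" "\<lambda>t. pd a F (v(a := t))"] D
      by (cases "u a < v a") (force simp: algebra_simps)+
    thus ?thesis
      by (intro bexI[of _ t]) (auto simp: v'_def closed_segment_eq_real_ivl split: if_splits)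
  qed
  then obtain t where t: "t \<in> closed_segment (u a) (v a)"
    "F v - F v' = pd a F (v(a := t)) * (v a - u a)" by blast
  define \<xi>' where "\<xi>' = \<xi>(a := v(a := t))"
  have "(\<Sum>m\<in>A. pd m F (\<xi> m) * (v' m - u m)) = (\<Sum>m\<in>A. pd m F (\<xi>' m) * (v m - u m))"
    using insert.hyps by (intro sum.cong) (auto simp: \<xi>'_def v'_def)
  hence "F v - F u = (\<Sum>m\<in>insert a A. pd m F (\<xi>' m) * (v m - u m))"
    using insert.hyps t(2) \<xi>(2) by (simp add: \<xi>'_def)
  moreover have "\<xi>' m k \<in> closed_segment (u k) (v k)" for m k
    using seg t(1) by (auto simp: \<xi>'_def)
  ultimately show ?case by blast
qed

text \<open>Here \<open>u\<close> and \<open>v\<close> may differ at infinitely many sites;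
  replacing \<open>v\<close> by \<open>u\<close> off \<open>A\<close> leaves \<open>F v\<close>
  unchanged and reduces to the finite case.\<close>

lemma mean_value_depends_only:
  assumes "finite A"
    and diff: "\<And>i x. (\<lambda>t. F (x(i := x i + t))) differentiable (at 0)"
    and dep: "depends_only_on F A"
  shows "\<exists>\<xi>. (\<forall>m k. \<xi> m k \<in> closed_segment (u k) (v k)) \<and>
              F v - F u = (\<Sum>m\<in>A. pd m F (\<xi> m) * (v m - u m))"
proof -
  define v' where "v' = (\<lambda>k. if k \<in> A then v k else u k)"
  have out: "v' k = u k" if "k \<notin> A" for k
    using that by (simp add: v'_def)
  obtain \<xi> where \<xi>: "\<And>m k. \<xi> m k \<in> closed_segment (u k) (v' k)"
    "F v' - F u = (\<Sum>m\<in>A. pd m F (\<xi> m) * (v' m - u m))"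
    using mean_value_coordinatewise[of A F v' u, OF assms(1) diff out] by blast
  have "F v' = F v" using dep unfolding depends_only_on_def v'_def by auto
  moreover have "\<xi> m k \<in> closed_segment (u k) (v k)" for m k
    using \<xi>(1)[of m k] by (auto simp: v'_def split: if_splits)
  moreover have "(\<Sum>m\<in>A. pd m F (\<xi> m) * (v' m - u m)) = (\<Sum>m\<in>A. pd m F (\<xi> m) * (v m - u m))"
    by (intro sum.cong) (auto simp: v'_def)
  ultimately show ?thesis using \<xi>(2) by metis
qed

lemma closed_segment_dist_real: "(x::real) \<in> closed_segment a b \<Longrightarrow> \<bar>x - a\<bar> \<le> \<bar>b - a\<bar>"
  by (auto simp: closed_segment_eq_real_ivl split: if_splits)

section \<open>Local potentials\<close>

text \<open>Meant for estimates of \<open>F v - F u\<close> by finitely many coordinates of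
  \<open>v\<close>: such a modulus is continuous in the product topology.\<close>

lemma continuous_on_UNIV_if_modulus:
  fixes F :: "'a::topological_space \<Rightarrow> real"
  assumes "\<And>u v. \<bar>F v - F u\<bar> \<le> H u v" "\<And>u. continuous_on UNIV (H u)" "\<And>u. H u u = 0"
  shows "continuous_on UNIV F"
proof -
  have "(F \<longlongrightarrow> F u) (at u)" for u
  proof -
    have "(H u \<longlongrightarrow> 0) (at u)"
      using assms(2)[of u] assms(3)[of u] by (metis UNIV_I continuous_on_def)
    hence "((\<lambda>v. F v - F u) \<longlongrightarrow> 0) (at u)"
      by (rule Lim_null_comparison[rotated]) (simp add: assms(1))
    thus ?thesis by (rule LIM_zero_cancel)
  qed
  thus ?thesis by (simp add: continuous_on_def)
qed

locale potential_family =
  fixes S :: "'d::finite site \<Rightarrow> 'd config \<Rightarrow> real" and r :: real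
  assumes potentials: "local_potentials S r"
begin

lemma r_pos: "0 < r"
  using potentials by (simp add: local_potentials_def)

lemma center_in_sball [simp]: "j \<in> sball j r"
  using r_pos by (simp add: sball_center)

lemma S_depends: "depends_only_on (S j) (sball j r)"
  using potentials by (simp add: local_potentials_def)

lemma C2_S: "C2_fun (S j)"
  using potentials by (simp add: local_potentials_def)

lemma S_differentiable: "(\<lambda>t. S j (x(i := x i + t))) differentiable (at 0)"
  using C2_S[of j] unfolding C2_fun_def by (elim conjE) simp

lemma pd_S_differentiable: "(\<lambda>t. pd k (S j) (x(i := x i + t))) differentiable (at 0)"
  using C2_S[of j] unfolding C2_fun_def by (elim conjE) simp

lemma S_tau: "S j (tau k l x) = S (j + k) x"
  using potentials by (simp add: local_potentials_def)

lemma pd_S_eq_0: "i \<notin> sball j r \<Longrightarrow> pd i (S j) x = 0"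
  using pd_eq_0 S_depends by blast

definition C :: real where
  "C = (SOME C. \<forall>i k j x. \<bar>pd k (pd i (S j)) x\<bar> \<le> C)"

text \<open>By translation this is the size of every ball of radius \<open>r\<close>; since balls
  are symmetric, it also bounds the number of potentials that see a given site.\<close>

definition nb :: real where
  "nb = real (card (sball (0 :: 'd site) r))"

lemma hessian_le: "\<bar>pd k (pd i (S j)) x\<bar> \<le> C"
proof -
  have "\<exists>C. \<forall>i k j x. \<bar>pd k (pd i (S j)) x\<bar> \<le> C"
    using potentials unfolding local_potentials_def by blast
  from someI_ex[OF this] show ?thesis unfolding C_def by blast
qed

lemma C_nonneg: "0 \<le> C"
  using hessian_le[of undefined undefined undefined undefined] by linarith

lemma nb_nonneg: "0 \<le> nb"
  by (simp add: nb_def)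

lemma nb: "real (card (sball (j :: 'd site) r)) = nb"
  by (metis card_sball nb_def)

lemma pd_tau: "pd i (S j) (tau k l x) = pd (i + k) (S (j + k)) x"
  unfolding pd_def tau_update S_tau ..

lemma gradW_tau: "gradW S r (tau k l x) i = gradW S r x (i + k)"
proof -
  have "gradW S r x (i + k) = (\<Sum>j\<in>(\<lambda>j. j + k) ` sball i r. pd (i + k) (S j) x)"
    unfolding gradW_def sball_image ..
  also have "\<dots> = (\<Sum>j\<in>sball i r. pd (i + k) (S (j + k)) x)"
    by (subst sum.reindex) (auto intro: inj_onI)
  finally show ?thesis by (simp add: gradW_def pd_tau)
qed

lemma stationary_iff: "stationary S r x \<longleftrightarrow> (\<forall>i. gradW S r x i = 0)"
  by (simp add: stationary_def gradW_def)

lemma stationary_tau [simp]: "stationary S r (tau k l x) \<longleftrightarrow> stationary S r x"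
  unfolding stationary_iff gradW_tau by (metis diff_add_cancel)

lemma pd_Lipschitz:
  "\<bar>pd i (S j) v - pd i (S j) u\<bar> \<le> C * (\<Sum>k\<in>sball j r. \<bar>v k - u k\<bar>)"
proof -
  obtain \<xi> where "pd i (S j) v - pd i (S j) u =
      (\<Sum>m\<in>sball j r. pd m (pd i (S j)) (\<xi> m) * (v m - u m))"
    using mean_value_depends_only[of "sball j r" "pd i (S j)" u v]
      pd_S_differentiable pd_depends_only_on[OF S_depends] by auto
  also have "\<bar>\<dots>\<bar> \<le> (\<Sum>m\<in>sball j r. C * \<bar>v m - u m\<bar>)"
    by (rule order.trans[OF sum_abs])
      (intro sum_mono, simp add: abs_mult hessian_le mult_right_mono)
  finally show ?thesis by (simp add: sum_distrib_left)
qed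

text \<open>After the mean value theorem, each intermediate configuration is replaced by
  \<open>u\<close>. It lies in the box between \<open>u\<close> and \<open>v\<close>, so
  \<open>pd_Lipschitz\<close> bounds the change of each derivative by \<open>C\<close> times the
  distance on the ball.\<close>

lemma S_expansion:
  "\<bar>S j v - S j u - (\<Sum>k\<in>sball j r. pd k (S j) u * (v k - u k))\<bar>
    \<le> C * (\<Sum>k\<in>sball j r. \<bar>v k - u k\<bar>)\<^sup>2"
proof -
  let ?D = "\<Sum>k\<in>sball j r. \<bar>v k - u k\<bar>"
  obtain \<xi> where \<xi>: "\<And>m k. \<xi> m k \<in> closed_segment (u k) (v k)"
      "S j v - S j u = (\<Sum>m\<in>sball j r. pd m (S j) (\<xi> m) * (v m - u m))"
    using mean_value_depends_only[of "sball j r" "S j" u v] S_differentiable S_depends by auto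
  have "\<bar>pd m (S j) (\<xi> m) - pd m (S j) u\<bar> \<le> C * ?D" for m
    by (rule order.trans[OF pd_Lipschitz])
      (intro mult_left_mono sum_mono closed_segment_dist_real \<xi>(1) C_nonneg)
  hence "\<bar>(pd m (S j) (\<xi> m) - pd m (S j) u) * (v m - u m)\<bar> \<le> C * ?D * \<bar>v m - u m\<bar>" for m
    by (simp add: abs_mult mult_right_mono)
  hence "\<bar>\<Sum>m\<in>sball j r. (pd m (S j) (\<xi> m) - pd m (S j) u) * (v m - u m)\<bar>
     \<le> (\<Sum>m\<in>sball j r. C * ?D * \<bar>v m - u m\<bar>)"
    by (intro order.trans[OF sum_abs] sum_mono)
  also have "\<dots> = C * ?D\<^sup>2"
    by (simp add: sum_distrib_left[symmetric] power2_eq_square)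
  finally show ?thesis
    by (simp add: \<xi>(2) sum_subtractf left_diff_distrib)
qed

lemma continuous_pd: "continuous_on UNIV (pd i (S j))"
  by (rule continuous_on_UNIV_if_modulus[OF pd_Lipschitz]) (auto intro!: continuous_intros)

lemma continuous_S: "continuous_on UNIV (S j)"
proof (rule continuous_on_UNIV_if_modulus)
  fix u v
  show "\<bar>S j v - S j u\<bar> \<le> \<bar>\<Sum>k\<in>sball j r. pd k (S j) u * (v k - u k)\<bar>
      + C * (\<Sum>k\<in>sball j r. \<bar>v k - u k\<bar>)\<^sup>2"
    using S_expansion[of j v u] by linarith
qed (auto intro!: continuous_intros)

lemma continuous_gradW: "continuous_on UNIV (\<lambda>x. gradW S r x i)"
  unfolding gradW_def
  by (intro continuous_on_sum continuous_pd)

lemma continuous_WB: "continuous_on UNIV (WB S B)"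
  unfolding WB_def by (intro continuous_on_sum continuous_S)

section \<open>Global minimizers: stationarity, translates and limits\<close>

lemma global_minimizer_stationary:
  assumes "global_minimizer S r x"
  shows "stationary S r x"
proof -
  have "(\<Sum>j\<in>sball i r. pd i (S j) x) = 0" for i
  proof -
    \<comment> \<open>\<open>i\<close> is an inner site of \<open>sball i r\<close>, so moving
      \<open>x i\<close> alone is an admissible variation; the sum over this ball contains every
      potential that sees \<open>i\<close>, so its derivative is the gradient entry.\<close>
    let ?f = "\<lambda>t. WB S (sball i r) (x(i := t))"
    have "((\<lambda>t. S j (x(i := t))) has_real_derivative pd i (S j) x) (at (x i))" for j
      using DERIV_pd[OF S_differentiable, of j x i "x i"] by (simp only: fun_upd_triv)
    hence D: "(?f has_real_derivative (\<Sum>j\<in>sball i r. pd i (S j) x)) (at (x i))"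
      unfolding WB_def by (intro DERIV_sum)
    have "?f (x i) \<le> ?f t" for t
    proof -
      define y where "y = (\<lambda>k. if k = i then t - x i else 0)"
      have "x + y = x(i := t)" by (rule ext) (simp add: y_def)
      moreover have "\<forall>k. k \<notin> inner_part (sball i r) r \<longrightarrow> y k = 0"
        by (auto simp: y_def inner_part_def)
      ultimately show ?thesis
        using assms unfolding global_minimizer_def by (metis finite_sball fun_upd_triv)
    qed
    thus ?thesis using DERIV_local_min[OF D zero_less_one] by blast
  qed
  thus ?thesis by (simp add: stationary_def)
qed

lemma global_minimizer_tau:
  assumes "global_minimizer S r x"
  shows "global_minimizer S r (tau k l x)"
  unfolding global_minimizer_def
proof (intro allI impI)
  fix B :: "'d site set" and y :: "'d config"
  assume B: "finite B" and y: "\<forall>i. i \<notin> inner_part B r \<longrightarrow> y i = 0"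
  \<comment> \<open>By (B), translating the configuration amounts to shifting the domain. The
    perturbation is a difference of configurations, hence carries no vertical shift.\<close>
  let ?B = "(\<lambda>i. i + k) ` B" and ?y = "tau (-k) 0 y"
  have WB: "WB S B (tau k l z) = WB S ?B z" for z
    unfolding WB_def S_tau by (subst sum.reindex) (auto intro: inj_onI)
  have "i - k \<in> inner_part B r \<Longrightarrow> i \<in> inner_part ?B r" for i
    using sball_image[of "i - k" k r] by (force simp: inner_part_def)
  hence "\<forall>i. i \<notin> inner_part ?B r \<longrightarrow> ?y i = 0"
    using y by (auto simp: tau_def)
  hence "WB S ?B x \<le> WB S ?B (x + ?y)"
    using assms B unfolding global_minimizer_def by blast
  also have "\<dots> = WB S B (tau k l (x + ?y))" by (simp add: WB)
  also have "tau k l (x + ?y) = tau k l x + y"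
    by (auto simp: tau_def fun_eq_iff)
  finally show "WB S B (tau k l x) \<le> WB S B (tau k l x + y)" by (simp only: WB)
qed

text \<open>For fixed \<open>B\<close> and \<open>y\<close> the defining inequality compares two
  functions that are continuous in the pointwise topology.\<close>

lemma closed_global_minimizer: "closed {x. global_minimizer S r x}"
proof -
  have "continuous_on UNIV (\<lambda>x. WB S B (x + y))" for B y
  proof -
    have "continuous_on UNIV (\<lambda>x::'d config. x + y)"
      unfolding plus_fun_def
      by (intro continuous_on_coordinatewise_then_product continuous_on_add continuous_on_const
          continuous_on_product_coordinates)
    thus ?thesis
      by (rule continuous_on_compose2[OF continuous_WB]) auto
  qed
  thus ?thesis
    unfolding global_minimizer_def
    by (intro closed_Collect_all closed_Collect_imp closed_Collect_le continuous_WB open_Collect_const)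
qed

text \<open>In the rational and the irrational case alike, the set lies in the closure of the
  translates of \<open>x\<close>.\<close>

lemma aubry_mather_global_minimizer:
  assumes "global_minimizer S r x" "y \<in> aubry_mather \<omega> x"
  shows "global_minimizer S r y"
proof -
  have "{tau k l x | k l. True} \<subseteq> {x. global_minimizer S r x}"
    using global_minimizer_tau[OF assms(1)] by auto
  hence "Mtilde x \<subseteq> {x. global_minimizer S r x}"
    unfolding Mtilde_def using closed_global_minimizer by (intro closure_minimal)
  thus ?thesis using assms(2) by (auto simp: aubry_mather_def split: if_splits)
qed

lemma closed_stationary: "closed {x. stationary S r x}"
  unfolding stationary_iff
  by (intro closed_Collect_all closed_Collect_eq continuous_gradW continuous_on_const)

end

section \<open>Ordered circles of configurations\<close>

text \<open>The order and translation structure of a ghost circle. The flow enters separately,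
  through the sign of \<open>gradW\<close>.\<close>

locale ordered_circle =
  fixes \<Gamma> :: "'d::finite config set"
  assumes nonempty: "\<Gamma> \<noteq> {}"
    and connected: "connected \<Gamma>"
    and ordered: "\<lbrakk>x \<in> \<Gamma>; y \<in> \<Gamma>\<rbrakk> \<Longrightarrow> strict_less x y \<or> x = y \<or> strict_less y x"
    and tau_in: "x \<in> \<Gamma> \<Longrightarrow> tau k l x \<in> \<Gamma>"
begin

text \<open>In a strictly ordered set a single coordinate decides the comparison at all sites; this
  and the next rules carry comparisons from site to site.\<close>

lemma eq_iff_coord: "\<lbrakk>x \<in> \<Gamma>; y \<in> \<Gamma>\<rbrakk> \<Longrightarrow> x = y \<longleftrightarrow> x i = y i"
  using ordered[of x y] unfolding strict_less_def by (metis order_less_irrefl)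

lemma less_iff_coord: "\<lbrakk>x \<in> \<Gamma>; y \<in> \<Gamma>\<rbrakk> \<Longrightarrow> strict_less x y \<longleftrightarrow> x i < y i"
  using ordered[of x y] unfolding strict_less_def by (metis order_less_asym order_less_irrefl)

lemma coord_less_iff: "\<lbrakk>x \<in> \<Gamma>; y \<in> \<Gamma>\<rbrakk> \<Longrightarrow> x k < y k \<longleftrightarrow> x i < y i"
  using less_iff_coord by metis

lemma coord_le_iff: "\<lbrakk>x \<in> \<Gamma>; y \<in> \<Gamma>\<rbrakk> \<Longrightarrow> x k \<le> y k \<longleftrightarrow> x i \<le> y i"
  using coord_less_iff[of y x k i] by linarith

text \<open>The values at site \<open>k\<close> form a connected set of reals, and vertical shifts
  make it unbounded in both directions.\<close>

lemma ex_leaf: "\<exists>y\<in>\<Gamma>. y k = \<xi>"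
proof -
  obtain e where e: "e \<in> \<Gamma>" using nonempty by blast
  define m where "m = \<lceil>\<bar>\<xi> - e k\<bar>\<rceil>"
  have lo: "tau 0 (- m) e \<in> \<Gamma>" "tau 0 (- m) e k \<le> \<xi>"
    using tau_in[OF e] by (simp, simp add: m_def tau_def, linarith)
  have hi: "tau 0 m e \<in> \<Gamma>" "\<xi> \<le> tau 0 m e k"
    using tau_in[OF e] by (simp, simp add: m_def tau_def, linarith)
  have "connected ((\<lambda>y. y k) ` \<Gamma>)"
    by (rule connected_continuous_image[OF _ connected])
      (rule continuous_on_subset[OF continuous_on_product_coordinates], simp)
  hence "\<xi> \<in> (\<lambda>y. y k) ` \<Gamma>"
    using connected_contains_Icc[of "(\<lambda>y. y k) ` \<Gamma>" "tau 0 (- m) e k" "tau 0 m e k"] lo hi by force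
  thus ?thesis by auto
qed

text \<open>The parametrisation of \<Gamma> by the coordinate at \<open>k\<close>. The site is kept
  variable so that each gradient entry can be integrated against its own coordinate.\<close>

definition leaf :: "'d site \<Rightarrow> real \<Rightarrow> 'd config" where
  "leaf k \<xi> = (SOME y. y \<in> \<Gamma> \<and> y k = \<xi>)"

lemma leaf_in [simp]: "leaf k \<xi> \<in> \<Gamma>" and leaf_coord [simp]: "leaf k \<xi> k = \<xi>"
proof -
  have "\<exists>y. y \<in> \<Gamma> \<and> y k = \<xi>" using ex_leaf by blast
  from someI_ex[OF this] show "leaf k \<xi> \<in> \<Gamma>" "leaf k \<xi> k = \<xi>"
    unfolding leaf_def by simp_all
qed

lemma leaf_eq: "y \<in> \<Gamma> \<Longrightarrow> leaf k (y k) = y"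
  using eq_iff_coord[of "leaf k (y k)" y k] by simp

lemma leaf_less_iff: "leaf k \<xi> i < leaf k \<eta> i \<longleftrightarrow> \<xi> < \<eta>"
  using coord_less_iff[of "leaf k \<xi>" "leaf k \<eta>" i k] by simp

lemma leaf_le_iff: "leaf k \<xi> i \<le> leaf k \<eta> i \<longleftrightarrow> \<xi> \<le> \<eta>"
  using leaf_less_iff[of k \<eta> i \<xi>] by linarith

text \<open>A monotone map of the reals onto the reals is continuous.\<close>

lemma continuous_leaf_coord: "continuous_on UNIV (\<lambda>\<xi>. leaf k \<xi> i)"
proof (rule continuous_onI_mono)
  have "surj (\<lambda>\<xi>. leaf k \<xi> i)"
    unfolding surj_def by (metis leaf_eq leaf_in leaf_coord)
  thus "open (range (\<lambda>\<xi>. leaf k \<xi> i))" by simp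
qed (simp add: leaf_le_iff)

lemma continuous_leaf: "continuous_on UNIV (leaf k)"
  by (intro continuous_on_coordinatewise_then_product continuous_leaf_coord)

lemma tau_leaf: "tau k l (leaf (i + k) \<xi>) = leaf i (\<xi> + l)"
  using leaf_eq[of "tau k l (leaf (i + k) \<xi>)" i] tau_in by (simp add: tau_def)

lemma le_tau_one_below:
  assumes "e \<in> \<Gamma>" "z \<in> \<Gamma>"
  shows "\<exists>l. e \<le> tau k l z \<and> (\<forall>i. tau k l z i \<le> e i + 1)"
proof -
  \<comment> \<open>This puts the translate between \<open>e\<close> and \<open>e + 1\<close> at
    site 0; the order of \<Gamma> carries both bounds to every site.\<close>
  define l where "l = \<lceil>e 0 - z k\<rceil>"
  have z': "tau k l z \<in> \<Gamma>" and e': "tau 0 1 e \<in> \<Gamma>" using assms tau_in by auto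
  have "e 0 \<le> tau k l z 0" "tau k l z 0 \<le> tau 0 1 e 0"
    unfolding tau_def l_def by (simp; linarith)+
  hence "e i \<le> tau k l z i" "tau k l z i \<le> tau 0 1 e i" for i
    using coord_le_iff assms(1) z' e' by blast+
  thus ?thesis by (auto simp: le_fun_def tau_def)
qed

end

section \<open>Bounds and sign of the gradient on the circle\<close>

locale circle_in_potential = potential_family S r + ordered_circle \<Gamma>
  for S :: "'d::finite site \<Rightarrow> 'd config \<Rightarrow> real" and r and \<Gamma> :: "'d config set"
begin

text \<open>The first term is the size of the derivatives at a reference element, the second the
  Lipschitz error within distance 2 of it.\<close>

definition G :: real where
  "G = (\<Sum>i\<in>sball 0 r. \<bar>pd i (S 0) (leaf 0 0)\<bar>) + 2 * C * nb"

lemma G_nonneg: "0 \<le> G"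
  unfolding G_def using C_nonneg nb_nonneg by (auto intro!: add_nonneg_nonneg sum_nonneg)

text \<open>By shift invariance it suffices to bound the partial derivatives of \<open>S 0\<close> at distance at most 2
  from one fixed element of \<open>\<Gamma>\<close>, where they are Lipschitz.\<close>

lemma pd_bounded:
  assumes "z \<in> \<Gamma>" "z \<le> v" "\<And>i. v i \<le> z i + 1"
  shows "\<bar>pd i (S j) v\<bar> \<le> G"
proof -
  let ?e = "leaf 0 0"
  obtain l where l: "?e \<le> tau j l z" "\<And>i. tau j l z i \<le> ?e i + 1"
    using le_tau_one_below[of ?e z j] assms(1) by auto
  have d: "\<bar>tau j l v k - ?e k\<bar> \<le> 2" for k
    using l(2)[of k] le_funD[OF l(1), of k] le_funD[OF assms(2), of "k + j"] assms(3)[of "k + j"]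
    unfolding tau_def by linarith
  have "\<bar>pd (i - j) (S 0) ?e\<bar> \<le> (\<Sum>i\<in>sball 0 r. \<bar>pd i (S 0) ?e\<bar>)"
  proof (cases "i - j \<in> sball 0 r")
    case True
    thus ?thesis
      using member_le_sum[of "i - j" "sball 0 r" "\<lambda>i. \<bar>pd i (S 0) ?e\<bar>"] by simp
  next
    case False
    thus ?thesis by (simp add: pd_S_eq_0 sum_nonneg)
  qed
  moreover have "\<bar>pd (i - j) (S 0) (tau j l v) - pd (i - j) (S 0) ?e\<bar>
      \<le> C * (\<Sum>k\<in>sball 0 r. \<bar>tau j l v k - ?e k\<bar>)"
    by (rule pd_Lipschitz)
  moreover have "\<dots> \<le> C * (\<Sum>k\<in>sball (0 :: 'd site) r. 2)"
    using d C_nonneg by (intro mult_left_mono sum_mono)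
  moreover have "\<dots> = 2 * C * nb" by (simp add: nb_def)
  moreover have "pd i (S j) v = pd (i - j) (S 0) (tau j l v)"
    by (simp add: pd_tau)
  ultimately show ?thesis unfolding G_def by linarith
qed

lemma gradW_bounded:
  assumes "y \<in> \<Gamma>" shows "\<bar>gradW S r y i\<bar> \<le> nb * G"
proof -
  have "\<bar>gradW S r y i\<bar> \<le> (\<Sum>j\<in>sball i r. G)"
    unfolding gradW_def
    by (intro order.trans[OF sum_abs] sum_mono pd_bounded[OF assms]) auto
  thus ?thesis by (simp add: nb)
qed

text \<open>\<open>\<Psi> h y\<close> is again in \<Gamma>, hence equal to \<open>y\<close> or on
  one side of it at all sites. Its difference quotients tend to minus the gradient, so two entries
  of opposite sign would place it on both sides.\<close>

lemma gradW_one_signed: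
  assumes "is_flow S r \<Psi>" "\<And>x. x \<in> \<Gamma> \<Longrightarrow> inX x" "\<And>t x. x \<in> \<Gamma> \<Longrightarrow> \<Psi> t x \<in> \<Gamma>" "y \<in> \<Gamma>"
  shows "(\<forall>i. 0 \<le> gradW S r y i) \<or> (\<forall>i. gradW S r y i \<le> 0)"
proof -
  let ?f = "\<lambda>h i. (\<Psi> h y i - y i) / h + gradW S r y i"
  have sol: "\<Psi> 0 y = y" "is_solution S r (\<lambda>t. \<Psi> t y)"
    using assms unfolding is_flow_def by auto
  hence lim: "((\<lambda>h. Xnorm (?f h)) \<longlongrightarrow> 0) (at 0)"
    unfolding is_solution_def by (elim conjE allE[of _ 0]) (simp add: sol(1))
  have w: "0 < weight i" for i :: "'d site" by (simp add: weight_def)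
  have X: "(\<lambda>i. weight i * \<bar>x i\<bar>) summable_on UNIV" if "x \<in> \<Gamma>" for x
    using assms(2)[OF that] by (simp add: inX_def)
  \<comment> \<open>Since \<open>infsum\<close> is 0 on non-summable families, \<open>lim\<close> says something only after summability
    of \<open>?f h\<close> is known; the weights are summable because both \<open>y\<close> and \<open>y + 1\<close> lie in X.\<close>
  have "(\<lambda>i. weight i :: real) summable_on (UNIV :: 'd site set)"
  proof (rule summable_on_comparison_test)
    show "(\<lambda>i. weight i * \<bar>tau 0 1 y i\<bar> + weight i * \<bar>y i\<bar>) summable_on UNIV"
      using X tau_in assms(4) by (intro summable_on_add) auto
    show "weight i \<le> weight i * \<bar>tau 0 1 y i\<bar> + weight i * \<bar>y i\<bar>" for i
    proof -
      have "1 \<le> \<bar>tau 0 1 y i\<bar> + \<bar>y i\<bar>" unfolding tau_def by simp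
      from mult_left_mono[OF this less_imp_le[OF w[of i]]] show ?thesis by (simp add: distrib_left)
    qed
  qed (use w less_imp_le in blast)
  hence "(\<lambda>i. (weight i * \<bar>\<Psi> h y i\<bar> + weight i * \<bar>y i\<bar>) * (1 / \<bar>h\<bar>) + weight i * (nb * G))
      summable_on UNIV" for h
    using X assms(3,4) by (intro summable_on_add summable_on_cmult_left) auto
  hence summable: "(\<lambda>i. weight i * \<bar>?f h i\<bar>) summable_on UNIV" for h
  proof (rule summable_on_comparison_test)
    fix i
    have "\<bar>?f h i\<bar> \<le> \<bar>\<Psi> h y i - y i\<bar> / \<bar>h\<bar> + \<bar>gradW S r y i\<bar>"
      by (metis abs_divide abs_triangle_ineq)
    also have "\<dots> \<le> (\<bar>\<Psi> h y i\<bar> + \<bar>y i\<bar>) / \<bar>h\<bar> + nb * G"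
      by (intro add_mono gradW_bounded assms divide_right_mono) auto
    finally have "weight i * \<bar>?f h i\<bar> \<le> weight i * ((\<bar>\<Psi> h y i\<bar> + \<bar>y i\<bar>) / \<bar>h\<bar> + nb * G)"
      using w less_imp_le by (intro mult_left_mono) auto
    thus "weight i * \<bar>?f h i\<bar> \<le>
        (weight i * \<bar>\<Psi> h y i\<bar> + weight i * \<bar>y i\<bar>) * (1 / \<bar>h\<bar>) + weight i * (nb * G)"
      by (simp add: algebra_simps add_divide_distrib)
    show "0 \<le> weight i * \<bar>?f h i\<bar>" using w[of i] by simp
  qed
  \<comment> \<open>A single nonnegative term is at most the whole sum, so convergence in the
    weighted norm gives convergence at each site.\<close>
  have lim_i: "((\<lambda>h. ?f h i) \<longlongrightarrow> 0) (at 0)" for i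
  proof (rule Lim_null_comparison[OF _ tendsto_divide_zero[OF lim]], rule always_eventually, rule allI)
    fix h
    have "(\<Sum>i\<in>{i}. weight i * \<bar>?f h i\<bar>) \<le> Xnorm (?f h)"
      unfolding Xnorm_def using w less_imp_le
      by (intro finite_sum_le_infsum summable) (auto intro!: mult_nonneg_nonneg)
    thus "norm (?f h i) \<le> Xnorm (?f h) / weight i"
      using w[of i] by (simp add: field_simps)
  qed
  have "\<not> (gradW S r y i > 0 \<and> gradW S r y k < 0)" for i k
  proof
    assume *: "gradW S r y i > 0 \<and> gradW S r y k < 0"
    \<comment> \<open>Subtracting the gradient entry, the two conditions say that the difference
      quotient is negative at \<open>i\<close> and positive at \<open>k\<close>; restricting to
      \<open>h > 0\<close> turns these into signs of displacements.\<close>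
    have "\<forall>\<^sub>F h in at 0. ?f h i < gradW S r y i"
      using lim_i[of i] * by (auto dest: order_tendstoD(2))
    moreover have "\<forall>\<^sub>F h in at 0. ?f h k > gradW S r y k"
      using lim_i[of k] * by (auto dest: order_tendstoD(1))
    ultimately have "\<forall>\<^sub>F h in at 0. ?f h i < gradW S r y i \<and> ?f h k > gradW S r y k"
      by (rule eventually_conj)
    hence "\<forall>\<^sub>F h in at_right 0. ?f h i < gradW S r y i \<and> ?f h k > gradW S r y k"
      by (rule filter_leD[OF at_le, rotated]) simp
    moreover have "\<forall>\<^sub>F h::real in at_right 0. 0 < h"
      by (simp add: eventually_at_right_less)
    ultimately have "\<forall>\<^sub>F h::real in at_right 0.
        0 < h \<and> ?f h i < gradW S r y i \<and> ?f h k > gradW S r y k"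
      by eventually_elim simp
    then obtain h where h: "0 < h" "?f h i < gradW S r y i" "?f h k > gradW S r y k"
      using eventually_happens[of _ "at_right (0::real)"] by (auto simp: trivial_limit_at_right_real)
    hence "\<Psi> h y i < y i" "y k < \<Psi> h y k"
      by (simp_all add: divide_less_0_iff zero_less_divide_iff)
    thus False
      using coord_less_iff[of "\<Psi> h y" y i k] assms(3,4) by auto
  qed
  thus ?thesis by (meson not_le)
qed

end

section \<open>The potential along an arc between adjacent stationary configurations\<close>

text \<open>Bisection at a point where \<open>V\<close> has the mean of its end values: the
  increments of \<open>U\<close> telescope, and the sum of the quadratic errors halves each
  time.\<close>

lemma quadratic_increments:
  fixes \<Phi> U V :: "real \<Rightarrow> real"
  assumes "continuous_on UNIV V" "a \<le> b"
    and incr: "\<And>s t. \<lbrakk>a \<le> s; s \<le> t; t \<le> b\<rbrakk> \<Longrightarrow> \<bar>\<Phi> t - \<Phi> s\<bar> \<le> U t - U s + L * (V t - V s)\<^sup>2"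
  shows "\<bar>\<Phi> b - \<Phi> a\<bar> \<le> U b - U a"
proof -
  have halving: "\<bar>\<Phi> t - \<Phi> s\<bar> \<le> U t - U s + L * (V t - V s)\<^sup>2 / 2 ^ m"
    if "a \<le> s" "s \<le> t" "t \<le> b" for s t m
    using that
  proof (induction m arbitrary: s t)
    case 0
    thus ?case using incr by simp
  next
    case (Suc m)
    have "\<exists>x\<ge>s. x \<le> t \<and> V x = (V s + V t) / 2"
      using IVT'[of V s "(V s + V t) / 2" t] IVT2'[of V t "(V s + V t) / 2" s]
        continuous_on_subset[OF assms(1)] Suc.prems(2) by (cases "V s \<le> V t") auto
    then obtain x where x: "s \<le> x" "x \<le> t" "V x = (V s + V t) / 2" by blast
    have h: "V x - V s = (V t - V s) / 2" "V t - V x = (V t - V s) / 2"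
      using x(3) by (simp_all add: field_simps)
    have "\<bar>\<Phi> x - \<Phi> s\<bar> \<le> U x - U s + L * ((V t - V s) / 2)\<^sup>2 / 2 ^ m"
      using Suc.IH[OF Suc.prems(1) x(1) order.trans[OF x(2) Suc.prems(3)]] unfolding h(1) .
    moreover have "\<bar>\<Phi> t - \<Phi> x\<bar> \<le> U t - U x + L * ((V t - V s) / 2)\<^sup>2 / 2 ^ m"
      using Suc.IH[OF order.trans[OF Suc.prems(1) x(1)] x(2) Suc.prems(3)] unfolding h(2) .
    moreover have "L * (V t - V s)\<^sup>2 / 2 ^ Suc m = 2 * (L * ((V t - V s) / 2)\<^sup>2 / 2 ^ m)"
      by (simp add: field_simps power2_eq_square)
    ultimately show ?case by linarith
  qed
  have "(\<lambda>m. U b - U a + L * (V b - V a)\<^sup>2 * (1 / 2) ^ m) \<longlonglongrightarrow> U b - U a + L * (V b - V a)\<^sup>2 * 0"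
    by (intro tendsto_intros) auto
  moreover have "\<bar>\<Phi> b - \<Phi> a\<bar> \<le> U b - U a + L * (V b - V a)\<^sup>2 * (1 / 2) ^ m" for m
    using halving[of a b m] assms(2) by (simp add: power_divide)
  ultimately show ?thesis
    using LIMSEQ_le_const by fastforce
qed

text \<open>\<open>z\<close> and \<open>w\<close> are adjacent stationary elements of \<Gamma>.
  Translates of stationary elements are stationary, so no translate of \<open>z\<close> or
  \<open>w\<close> lies strictly between them; the order properties of the gap rest on this.\<close>

locale circle_gap = circle_in_potential S r \<Gamma>
  for S :: "'d::finite site \<Rightarrow> 'd config \<Rightarrow> real" and r and \<Gamma> :: "'d config set" +
  fixes z w :: "'d config"
  assumes z_in: "z \<in> \<Gamma>" and w_in: "w \<in> \<Gamma>" and z_less_w: "strict_less z w"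
    and z_stationary: "stationary S r z" and w_stationary: "stationary S r w"
    and no_stationary_between: "\<lbrakk>y \<in> \<Gamma>; strict_less z y; strict_less y w\<rbrakk> \<Longrightarrow> \<not> stationary S r y"
begin

lemma z_less_w_coord: "z i < w i"
  using z_less_w by (simp add: strict_less_def)

lemma gap_le_1: "w i \<le> z i + 1"
proof (rule ccontr)
  assume "\<not> ?thesis"
  hence "strict_less (tau 0 1 z) w"
    using less_iff_coord[OF tau_in[OF z_in] w_in, of 0 1 i] by (simp add: tau_def)
  moreover have "strict_less z (tau 0 1 z)" by (simp add: strict_less_def tau_def)
  ultimately show False
    using no_stationary_between[of "tau 0 1 z"] tau_in z_in z_stationary by simp
qed

definition grad_leaf :: "'d site \<Rightarrow> real \<Rightarrow> real" where
  "grad_leaf k \<xi> = gradW S r (leaf k \<xi>) k"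

text \<open>The contribution of site \<open>k\<close> to the line integral of \<open>gradW\<close>
  along \<Gamma> from \<open>z\<close> to \<open>w\<close>. The coordinate serves as parameter
  because the arc is known only to be continuous and monotone.\<close>

definition action :: "'d site \<Rightarrow> real" where
  "action k = integral {z k..w k} (grad_leaf k)"

lemma continuous_grad_leaf: "continuous_on UNIV (grad_leaf k)"
  unfolding grad_leaf_def
  by (rule continuous_on_compose2[OF continuous_gradW continuous_leaf]) auto

lemma grad_leaf_integrable: "grad_leaf k integrable_on {a..b}"
  by (intro integrable_continuous_real continuous_on_subset[OF continuous_grad_leaf]) auto

text \<open>The sites on which \<open>WB S B\<close> can depend.\<close>

definition reach :: "'d site set \<Rightarrow> 'd site set" where
  "reach B = (\<Union>j\<in>B. sball j r)"

lemma inner_subset_reach: "inner_part B r \<subseteq> reach B"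
  by (auto simp: inner_part_def reach_def)

lemma finite_reach: "finite B \<Longrightarrow> finite (reach B)"
  by (simp add: reach_def)

lemma sum_sball_reach:
  assumes "finite B" "\<And>j k. \<lbrakk>j \<in> B; k \<notin> sball j r\<rbrakk> \<Longrightarrow> f j k = 0"
  shows "(\<Sum>j\<in>B. \<Sum>k\<in>sball j r. f j k) = (\<Sum>k\<in>reach B. \<Sum>j\<in>B. f j k)"
proof -
  have "(\<Sum>j\<in>B. \<Sum>k\<in>sball j r. f j k) = (\<Sum>j\<in>B. \<Sum>k\<in>reach B. f j k)"
    using assms finite_reach by (intro sum.cong sum.mono_neutral_left) (auto simp: reach_def)
  also have "\<dots> = (\<Sum>k\<in>reach B. \<Sum>j\<in>B. f j k)" by (rule sum.swap)
  finally show ?thesis .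
qed

lemma sum_restrict_sball:
  assumes "finite B" "\<And>j. j \<notin> sball k r \<Longrightarrow> f j = 0"
  shows "(\<Sum>j\<in>B. f j) = (\<Sum>j\<in>B \<inter> sball k r. f j)"
  using assms by (intro sum.mono_neutral_right) auto

lemma card_inter_sball: "finite B \<Longrightarrow> real (card (B \<inter> sball (k :: 'd site) r)) \<le> nb"
  using card_mono[of "sball k r" "B \<inter> sball k r"] nb[of k] by force

text \<open>The leaf lies between \<open>u\<close> and \<open>v\<close> at site \<open>k\<close>,
  hence at all sites, so \<open>pd_Lipschitz\<close> applies with distances at most
  \<open>v l - u l\<close>.\<close>

lemma grad_leaf_near:
  assumes "finite B" "k \<in> inner_part B r" "u \<in> \<Gamma>" "v \<in> \<Gamma>" "\<xi> \<in> {u k..v k}"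
  shows "\<bar>grad_leaf k \<xi> - gradW S r u k\<bar> \<le> nb * C * (\<Sum>l\<in>reach B. v l - u l)"
proof -
  let ?y = "leaf k \<xi>"
  have y: "u l \<le> ?y l" "?y l \<le> v l" for l
    using coord_le_iff[of u ?y l k] coord_le_iff[of ?y v l k] assms by auto
  have le: "u l \<le> v l" for l using y order.trans by blast
  have "\<bar>pd k (S j) ?y - pd k (S j) u\<bar> \<le> C * (\<Sum>l\<in>reach B. v l - u l)" if "j \<in> sball k r" for j
  proof -
    have "sball j r \<subseteq> reach B" using that assms(2) by (auto simp: inner_part_def reach_def)
    hence "(\<Sum>l\<in>sball j r. \<bar>?y l - u l\<bar>) \<le> (\<Sum>l\<in>reach B. v l - u l)"
      using y le finite_reach[OF assms(1)]
      by (intro order.trans[OF sum_mono[of _ _ "\<lambda>l. v l - u l"] sum_mono2]) auto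
    thus ?thesis
      using order.trans[OF pd_Lipschitz mult_left_mono] C_nonneg by blast
  qed
  hence "(\<Sum>j\<in>sball k r. \<bar>pd k (S j) ?y - pd k (S j) u\<bar>)
      \<le> (\<Sum>j\<in>sball k r. C * (\<Sum>l\<in>reach B. v l - u l))"
    by (rule sum_mono)
  moreover have "\<bar>grad_leaf k \<xi> - gradW S r u k\<bar> \<le> (\<Sum>j\<in>sball k r. \<bar>pd k (S j) ?y - pd k (S j) u\<bar>)"
    unfolding grad_leaf_def gradW_def sum_subtractf[symmetric] by (rule sum_abs)
  ultimately show ?thesis by (simp add: nb mult.assoc)
qed

text \<open>First-order expansion at \<open>u\<close>. Inner sites give the integrals up to a
  quadratic error; the other sites are estimated by the derivative bound and form the boundary
  term.\<close>

lemma WB_increment: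
  assumes "finite B" "u \<in> \<Gamma>" "v \<in> \<Gamma>" "u \<le> v"
  shows "\<bar>WB S B v - WB S B u - (\<Sum>k\<in>inner_part B r. integral {u k..v k} (grad_leaf k))\<bar>
    \<le> nb * G * (\<Sum>k\<in>reach B - inner_part B r. v k - u k)
      + (real (card B) * C + nb * C) * (\<Sum>k\<in>reach B. v k - u k)\<^sup>2"
proof -
  let ?I = "inner_part B r" and ?D = "\<Sum>k\<in>reach B. v k - u k"
  define g where "g k = (\<Sum>j\<in>B. pd k (S j) u)" for k
  have le: "u k \<le> v k" for k using assms(4) by (simp add: le_fun_def)
  have D: "0 \<le> ?D" using le by (intro sum_nonneg) simp
  have "\<bar>S j v - S j u - (\<Sum>k\<in>sball j r. pd k (S j) u * (v k - u k))\<bar> \<le> C * ?D\<^sup>2"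
    if "j \<in> B" for j
  proof -
    have "(\<Sum>k\<in>sball j r. \<bar>v k - u k\<bar>) \<le> ?D"
      using le that finite_reach[OF assms(1)]
      by (intro order.trans[OF sum_mono[of _ _ "\<lambda>l. v l - u l"] sum_mono2])
        (auto simp: reach_def)
    thus ?thesis
      by (intro order.trans[OF S_expansion] mult_left_mono power_mono C_nonneg sum_nonneg) auto
  qed
  hence "(\<Sum>j\<in>B. \<bar>S j v - S j u - (\<Sum>k\<in>sball j r. pd k (S j) u * (v k - u k))\<bar>)
      \<le> (\<Sum>j\<in>B. C * ?D\<^sup>2)"
    by (rule sum_mono)
  from order.trans[OF sum_abs this]
  have "\<bar>WB S B v - WB S B u - (\<Sum>j\<in>B. \<Sum>k\<in>sball j r. pd k (S j) u * (v k - u k))\<bar>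
      \<le> real (card B) * C * ?D\<^sup>2"
    by (simp add: WB_def sum_subtractf mult.assoc)
  \<comment> \<open>Regrouped by sites: \<open>g k\<close> is the derivative of
    \<open>WB S B\<close> at \<open>u\<close> in direction \<open>k\<close>.\<close>
  moreover have "(\<Sum>j\<in>B. \<Sum>k\<in>sball j r. pd k (S j) u * (v k - u k))
      = (\<Sum>k\<in>reach B. g k * (v k - u k))"
    using assms(1) by (simp add: sum_sball_reach pd_S_eq_0 g_def sum_distrib_right)
  moreover have "\<dots> = (\<Sum>k\<in>reach B - ?I. g k * (v k - u k)) + (\<Sum>k\<in>?I. g k * (v k - u k))"
    by (rule sum.subset_diff[OF inner_subset_reach finite_reach[OF assms(1)]])
  moreover have "\<bar>\<Sum>k\<in>reach B - ?I. g k * (v k - u k)\<bar>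
      \<le> nb * G * (\<Sum>k\<in>reach B - ?I. v k - u k)"
  proof -
    have "\<bar>g k\<bar> \<le> nb * G" for k
    proof -
      have "g k = (\<Sum>j\<in>B \<inter> sball k r. pd k (S j) u)"
        unfolding g_def using assms(1) pd_S_eq_0 sball_sym by (intro sum_restrict_sball) blast+
      also have "\<bar>\<dots>\<bar> \<le> (\<Sum>j\<in>B \<inter> sball k r. G)"
        by (intro order.trans[OF sum_abs] sum_mono pd_bounded[OF assms(2)]) auto
      also have "\<dots> \<le> nb * G"
        using card_inter_sball[OF assms(1)] G_nonneg by (simp add: mult_right_mono)
      finally show ?thesis .
    qed
    hence "\<bar>g k * (v k - u k)\<bar> \<le> nb * G * (v k - u k)" for k
      using le[of k] by (simp add: abs_mult mult_right_mono)
    thus ?thesis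
      unfolding sum_distrib_left by (intro order.trans[OF sum_abs] sum_mono)
  qed
  moreover have "\<bar>(\<Sum>k\<in>?I. g k * (v k - u k)) - (\<Sum>k\<in>?I. integral {u k..v k} (grad_leaf k))\<bar>
      \<le> nb * C * ?D\<^sup>2"
  proof -
    have "\<bar>g k * (v k - u k) - integral {u k..v k} (grad_leaf k)\<bar> \<le> nb * C * ?D * (v k - u k)"
      if k: "k \<in> ?I" for k
    proof -
      have "g k = (\<Sum>j\<in>B \<inter> sball k r. pd k (S j) u)"
        unfolding g_def using assms(1) pd_S_eq_0 sball_sym by (intro sum_restrict_sball) blast+
      \<comment> \<open>All potentials that see an inner site belong to \<open>B\<close>, so here
        \<open>g k\<close> is the full gradient entry.\<close>
      also have "B \<inter> sball k r = sball k r" using k by (auto simp: inner_part_def)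
      finally have g: "g k = gradW S r u k" by (simp add: gradW_def)
      have "norm (integral {u k..v k} (\<lambda>\<xi>. grad_leaf k \<xi> - g k)) \<le> nb * C * ?D * (v k - u k)"
        using grad_leaf_near[OF assms(1) k assms(2,3)] g le[of k]
        by (intro integral_bound continuous_intros continuous_on_subset[OF continuous_grad_leaf]) auto
      moreover have "integral {u k..v k} (\<lambda>\<xi>. grad_leaf k \<xi> - g k)
          = integral {u k..v k} (grad_leaf k) - g k * (v k - u k)"
        using le[of k] by (subst integral_diff) (auto simp: grad_leaf_integrable)
      ultimately show ?thesis by simp
    qed
    hence "(\<Sum>k\<in>?I. \<bar>g k * (v k - u k) - integral {u k..v k} (grad_leaf k)\<bar>)
        \<le> (\<Sum>k\<in>?I. nb * C * ?D * (v k - u k))"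
      by (rule sum_mono)
    also have "\<dots> \<le> nb * C * ?D * ?D"
      unfolding sum_distrib_left[symmetric]
      using le D C_nonneg nb_nonneg inner_subset_reach finite_reach[OF assms(1)]
      by (intro mult_left_mono sum_mono2) auto
    finally show ?thesis
      using sum_abs[of "\<lambda>k. g k * (v k - u k) - integral {u k..v k} (grad_leaf k)" ?I]
      by (simp add: sum_subtractf power2_eq_square mult.assoc)
  qed
  ultimately show ?thesis by (simp add: distrib_right)
qed

text \<open>Summing the increments over finer and finer subdivisions of the arc of \<open>\<Gamma>\<close> from \<open>z\<close>
  to \<open>w\<close> removes the quadratic error: this is a chain rule along \<open>\<Gamma>\<close>, each site being
  parametrised by its own coordinate.\<close>

lemma WB_along_circle:
  assumes "finite B"
  shows "\<bar>WB S B w - WB S B z - (\<Sum>k\<in>inner_part B r. action k)\<bar>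
    \<le> nb * G * (\<Sum>k\<in>reach B - inner_part B r. w k - z k)"
proof -
  let ?I = "inner_part B r" and ?L = "real (card B) * C + nb * C" and ?y = "leaf 0"
  define \<Phi> where "\<Phi> s = WB S B (?y s) - (\<Sum>k\<in>?I. integral {z k..?y s k} (grad_leaf k))" for s
  define U where "U s = nb * G * (\<Sum>k\<in>reach B - ?I. ?y s k)" for s
  define V where "V s = (\<Sum>k\<in>reach B. ?y s k)" for s
  have ends: "?y (z 0) = z" "?y (w 0) = w" using leaf_eq z_in w_in by auto
  have "\<bar>\<Phi> (w 0) - \<Phi> (z 0)\<bar> \<le> U (w 0) - U (z 0)"
  proof (rule quadratic_increments)
    show "continuous_on UNIV V"
      unfolding V_def by (intro continuous_on_sum continuous_leaf_coord)
    show "z 0 \<le> w 0" using z_less_w_coord[of 0] by simp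
    fix s t assume st: "z 0 \<le> s" "s \<le> t" "t \<le> w 0"
    have zs: "z k \<le> ?y s k" for k using leaf_le_iff[of 0 "z 0" k s] st ends by simp
    have yst: "?y s k \<le> ?y t k" for k using leaf_le_iff st by simp
    have "integral {z k..?y t k} (grad_leaf k) - integral {z k..?y s k} (grad_leaf k)
        = integral {?y s k..?y t k} (grad_leaf k)" for k
      using Henstock_Kurzweil_Integration.integral_combine[OF zs yst grad_leaf_integrable, of k k]
      by simp
    hence "(\<Sum>k\<in>?I. integral {?y s k..?y t k} (grad_leaf k))
       = (\<Sum>k\<in>?I. integral {z k..?y t k} (grad_leaf k)) - (\<Sum>k\<in>?I. integral {z k..?y s k} (grad_leaf k))"
      by (simp add: sum_subtractf[symmetric])
    thus "\<bar>\<Phi> t - \<Phi> s\<bar> \<le> U t - U s + ?L * (V t - V s)\<^sup>2"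
      using WB_increment[OF assms leaf_in leaf_in le_funI[OF yst]]
      by (simp add: \<Phi>_def U_def V_def sum_subtractf algebra_simps)
  qed
  thus ?thesis
    by (simp add: \<Phi>_def U_def ends action_def sum_subtractf algebra_simps)
qed

section \<open>Minimality of both ends bounds the sum of the actions\<close>

lemma minimizer_compare:
  assumes "finite B" "global_minimizer S r p" "p \<in> {z, w}" "q \<in> {z, w}"
  shows "WB S B p \<le> WB S B q + nb * G * (\<Sum>k\<in>reach B - inner_part B r. w k - z k)"
proof -
  let ?I = "inner_part B r"
  \<comment> \<open>The competitor for \<open>p\<close>: it agrees with \<open>q\<close> at inner
    sites, so it differs from \<open>q\<close> only at the boundary, and there by at most
    \<open>w - z\<close>.\<close>
  define p' where "p' = (\<lambda>k. if k \<in> ?I then q k else p k)"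
  have "WB S B p \<le> WB S B (p + (p' - p))"
    using assms(1,2) unfolding global_minimizer_def
    by (elim allE[of _ B] allE[of _ "p' - p"]) (simp add: p'_def)
  hence min: "WB S B p \<le> WB S B p'" by simp
  have q: "z k \<le> q k" "q k \<le> w k" and p': "z k \<le> p' k" "p' k \<le> w k" for k
    using z_less_w_coord[of k] assms(3,4) by (auto simp: p'_def)
  have "S j p' - S j q \<le> (\<Sum>k\<in>sball j r. G * \<bar>p' k - q k\<bar>)" for j
  proof -
    obtain \<xi> where \<xi>: "\<And>m k. \<xi> m k \<in> closed_segment (q k) (p' k)"
        "S j p' - S j q = (\<Sum>m\<in>sball j r. pd m (S j) (\<xi> m) * (p' m - q m))"
      using mean_value_depends_only[of "sball j r" "S j" q p'] S_differentiable S_depends by auto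
    have "z k \<le> \<xi> m k \<and> \<xi> m k \<le> w k" for m k
      using \<xi>(1)[of m k] q[of k] p'[of k] by (auto simp: closed_segment_eq_real_ivl split: if_splits)
    hence G: "\<bar>pd m (S j) (\<xi> m)\<bar> \<le> G" for m
      using gap_le_1 by (intro pd_bounded[OF z_in]) (auto simp: le_fun_def intro: order.trans)
    have "pd m (S j) (\<xi> m) * (p' m - q m) \<le> G * \<bar>p' m - q m\<bar>" for m
      using mult_right_mono[OF G[of m] abs_ge_zero[of "p' m - q m"]]
        abs_ge_self[of "pd m (S j) (\<xi> m) * (p' m - q m)"] unfolding abs_mult by linarith
    thus ?thesis unfolding \<xi>(2) by (rule sum_mono)
  qed
  \<comment> \<open>The conditional is vacuous here; it makes the summand vanish off the ball, as
    the exchange of sums requires.\<close>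
  hence "WB S B p' - WB S B q \<le> (\<Sum>j\<in>B. \<Sum>k\<in>sball j r. if k \<in> sball j r then G * \<bar>p' k - q k\<bar> else 0)"
    unfolding WB_def sum_subtractf[symmetric] by (intro sum_mono) (simp cong: sum.cong)
  also have "\<dots> = (\<Sum>k\<in>reach B. \<Sum>j\<in>B. if k \<in> sball j r then G * \<bar>p' k - q k\<bar> else 0)"
    using assms(1) by (intro sum_sball_reach) auto
  also have "\<dots> \<le> (\<Sum>k\<in>reach B. nb * G * \<bar>p' k - q k\<bar>)"
  proof (rule sum_mono)
    fix k
    have "(\<Sum>j\<in>B. if k \<in> sball j r then G * \<bar>p' k - q k\<bar> else 0)
        = real (card (B \<inter> sball k r)) * (G * \<bar>p' k - q k\<bar>)"
      using assms(1) by (simp add: sball_sym[of k] sum.If_cases Int_def)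
    also have "\<dots> \<le> nb * (G * \<bar>p' k - q k\<bar>)"
      using card_inter_sball[OF assms(1)] G_nonneg by (intro mult_right_mono) auto
    finally show "(\<Sum>j\<in>B. if k \<in> sball j r then G * \<bar>p' k - q k\<bar> else 0) \<le> nb * G * \<bar>p' k - q k\<bar>"
      by (simp add: mult.assoc)
  qed
  also have "\<dots> = (\<Sum>k\<in>reach B - ?I. nb * G * \<bar>p' k - q k\<bar>)"
    using finite_reach[OF assms(1)] inner_subset_reach
    by (intro sum.mono_neutral_right) (auto simp: p'_def)
  also have "\<dots> \<le> (\<Sum>k\<in>reach B - ?I. nb * G * (w k - z k))"
  proof (intro sum_mono mult_left_mono)
    show "\<bar>p' k - q k\<bar> \<le> w k - z k" for k using q[of k] p'[of k] by linarith
    show "0 \<le> nb * G" using nb_nonneg G_nonneg by simp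
  qed
  finally show ?thesis using min by (simp add: sum_distrib_left)
qed

text \<open>Minimality of \<open>z\<close> and of \<open>w\<close> bounds the difference of their
  potentials by one boundary term; \<open>WB_along_circle\<close> costs a second one.\<close>

lemma action_sum_le:
  assumes "finite B" "global_minimizer S r z" "global_minimizer S r w"
  shows "\<bar>\<Sum>k\<in>inner_part B r. action k\<bar>
    \<le> 2 * nb * G * (\<Sum>k\<in>reach B - inner_part B r. w k - z k)"
  using WB_along_circle[OF assms(1)] minimizer_compare[OF assms(1,2), of w]
    minimizer_compare[OF assms(1,3), of z] by simp

section \<open>Translations of the gap and its periods\<close>

lemma no_tau_between: "\<not> (strict_less (tau i l z) (tau j m z) \<and> strict_less (tau j m z) (tau i l w))"
proof
  assume "strict_less (tau i l z) (tau j m z) \<and> strict_less (tau j m z) (tau i l w)"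
  hence "strict_less z (tau (- i) (- l) (tau j m z))" "strict_less (tau (- i) (- l) (tau j m z)) w"
    using strict_less_tau[of "-i" "-l" "tau i l _"] by (metis strict_less_tau tau_inverse(2))+
  thus False
    using no_stationary_between[of "tau (- i) (- l) (tau j m z)"] z_stationary tau_in z_in by simp
qed

text \<open>The image of \<open>w\<close> is stationary and above the fixed \<open>z\<close>, so it
  is not strictly below \<open>w\<close>; the inverse translation excludes the other side.\<close>

lemma tau_w_period:
  assumes "tau k l z = z" shows "tau k l w = w"
proof -
  have ge: "\<not> strict_less (tau k l w) w" if "tau k l z = z" for k l
  proof
    assume "strict_less (tau k l w) w"
    moreover have "strict_less z (tau k l w)" using z_less_w that strict_less_tau by metis
    ultimately show False
      using no_stationary_between[of "tau k l w"] w_stationary tau_in w_in by simp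
  qed
  have "tau (- k) (- l) z = z" using assms tau_inverse(1) by metis
  hence "\<not> strict_less w (tau k l w)"
    using ge[of "-k" "-l"] strict_less_tau[of "-k" "-l" w "tau k l w"] by simp
  thus ?thesis using ge[OF assms] ordered[of "tau k l w" w] tau_in w_in by blast
qed

text \<open>The translation fixes both ends, so it shifts the interval of integration and the
  integrand by the same integer.\<close>

lemma action_period:
  assumes "tau k l z = z"
  shows "action (i + k) = action i"
proof -
  have z: "z (i + k) = z i - l" and w: "w (i + k) = w i - l"
    using fun_cong[OF assms, of i] fun_cong[OF tau_w_period[OF assms], of i]
    by (simp_all add: tau_def)
  have "grad_leaf (i + k) \<xi> = grad_leaf i (\<xi> + real_of_int l)" for \<xi>
    using gradW_tau[of k l "leaf (i + k) \<xi>" i] by (simp add: grad_leaf_def tau_leaf)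
  hence "grad_leaf (i + k) = (\<lambda>\<xi>. grad_leaf i (\<xi> + real_of_int l))" by auto
  thus ?thesis
    using integral_shift_real_ivl[of "z i" "real_of_int l" "w i" "grad_leaf i"]
    by (simp add: action_def z w)
qed

end

section \<open>Counting periods\<close>

text \<open>In the application \<open>P\<close> counts periods and \<open>A\<close> is the volume of
  the gap over a ball. Adding \<open>incr\<close> over consecutive shells bounds a large multiple of
  \<open>P\<close> at one radius by \<open>P\<close> at a comparable radius, which forces
  superpolynomial growth.\<close>

lemma growth_contradiction:
  fixes P A :: "nat \<Rightarrow> real" and H d :: nat
  assumes "0 < c" "0 \<le> D" "0 < H"
    and incr: "\<And>M. c * P M \<le> D * (A (M + H) - A M)"
    and A_le: "\<And>N. A N \<le> 2 * P (2 * N)" and A_nonneg: "\<And>N. 0 \<le> A N"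
    and "mono P" and P_ge: "\<And>N. 1 \<le> P N" and P_le: "\<And>N. P N \<le> real (2 * N + 1) ^ d"
  shows False
proof -
  have sum: "c * real Q * P M \<le> D * (A (M + Q * H) - A M)" for Q M
  proof (induction Q)
    case (Suc Q)
    have "c * P M \<le> c * P (M + Q * H)"
      using \<open>mono P\<close> \<open>0 < c\<close> by (simp add: monoD)
    also have "\<dots> \<le> D * (A (M + Suc Q * H) - A (M + Q * H))"
      using incr[of "M + Q * H"] by (simp add: ac_simps)
    finally show ?case using Suc.IH by (simp add: algebra_simps)
  qed simp
  \<comment> \<open>Starting at radius \<open>4 ^ n * H\<close> and adding \<open>4 ^ n\<close>
    shells of width \<open>H\<close> doubles the radius; \<open>A_le\<close> doubles it again, which
    leads exactly to the next term.\<close>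
  define p where "p n = P (4 ^ n * H)" for n
  have step: "c * 4 ^ n * p n \<le> 2 * D * p (Suc n)" for n
  proof -
    have "c * 4 ^ n * p n \<le> D * (A (4 ^ n * H + 4 ^ n * H) - A (4 ^ n * H))"
      using sum[of "4 ^ n" "4 ^ n * H"] by (simp add: p_def)
    also have "\<dots> \<le> D * (2 * P (2 * (4 ^ n * H + 4 ^ n * H)))"
    proof (rule mult_left_mono[OF _ \<open>0 \<le> D\<close>])
      show "A (4 ^ n * H + 4 ^ n * H) - A (4 ^ n * H) \<le> 2 * P (2 * (4 ^ n * H + 4 ^ n * H))"
        using A_le[of "4 ^ n * H + 4 ^ n * H"] A_nonneg[of "4 ^ n * H"] by linarith
    qed
    also have "2 * (4 ^ n * H + 4 ^ n * H) = 4 ^ Suc n * H" by simp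
    finally show ?thesis by (simp add: p_def)
  qed
  have p_ge: "1 \<le> p n" for n by (simp add: p_def P_ge)
  have "0 < D"
  proof (rule ccontr)
    assume "\<not> 0 < D"
    hence "D = 0" using \<open>0 \<le> D\<close> by simp
    thus False using step[of 0] p_ge[of 0] \<open>0 < c\<close> by (simp add: mult_le_0_iff)
  qed
  \<comment> \<open>A growth factor four times the \<open>4 ^ d\<close> that the polynomial bound
    allows per step.\<close>
  define \<Lambda> :: real where "\<Lambda> = 4 ^ Suc d"
  obtain n0 where n0: "2 * D * \<Lambda> / c < 4 ^ n0"
    using real_arch_pow[of 4 "2 * D * \<Lambda> / c"] by auto
  have geometric: "\<Lambda> * p n \<le> p (Suc n)" if "n0 \<le> n" for n
  proof -
    have "2 * D * \<Lambda> / c \<le> 4 ^ n"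
      using n0 power_increasing[OF that, of "4 :: real"] by linarith
    hence "2 * D * \<Lambda> \<le> c * 4 ^ n" using \<open>0 < c\<close> by (simp add: field_simps)
    hence "2 * D * \<Lambda> * p n \<le> c * 4 ^ n * p n"
      using p_ge[of n] by (intro mult_right_mono) auto
    also note step[of n]
    finally show ?thesis using \<open>0 < D\<close> by simp
  qed
  have lower: "\<Lambda> ^ m \<le> p (n0 + m)" for m
  proof (induction m)
    case (Suc m)
    have "\<Lambda> ^ Suc m \<le> \<Lambda> * p (n0 + m)" using Suc by (simp add: \<Lambda>_def)
    also have "\<dots> \<le> p (n0 + Suc m)" using geometric[of "n0 + m"] by simp
    finally show ?case .
  qed (simp add: p_ge)
  have upper: "p (n0 + m) \<le> (3 * 4 ^ n0 * real H) ^ d * (4 ^ d) ^ m" for m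
  proof -
    have "1 \<le> (4 :: real) ^ (n0 + m) * real H"
      using mult_mono[of 1 "(4::real) ^ (n0 + m)" 1 "real H"] \<open>0 < H\<close> by simp
    hence "real (2 * (4 ^ (n0 + m) * H) + 1) \<le> 3 * 4 ^ n0 * real H * 4 ^ m"
      by (simp add: power_add algebra_simps)
    hence "real (2 * (4 ^ (n0 + m) * H) + 1) ^ d \<le> (3 * 4 ^ n0 * real H * 4 ^ m) ^ d"
      by (rule power_mono) simp
    also have "\<dots> = (3 * 4 ^ n0 * real H) ^ d * (4 ^ d) ^ m"
      by (simp add: power_mult_distrib power_mult[symmetric] mult.commute)
    finally show ?thesis using P_le[of "4 ^ (n0 + m) * H"] by (simp add: p_def)
  qed
  obtain m where m: "(3 * 4 ^ n0 * real H) ^ d < 4 ^ m"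
    using real_arch_pow[of 4 "(3 * 4 ^ n0 * real H) ^ d"] by auto
  have "(4 :: real) ^ m * (4 ^ d) ^ m \<le> (3 * 4 ^ n0 * real H) ^ d * (4 ^ d) ^ m"
    using order.trans[OF lower upper, of m] by (simp add: \<Lambda>_def power_mult_distrib)
  thus False using m by simp
qed

section \<open>Disjoint translates bound the volume of the gap\<close>

context circle_gap
begin

definition periods :: "'d site set" where
  "periods = {k. \<exists>l. tau k l z = z}"

definition period_count :: "nat \<Rightarrow> real" where
  "period_count N = real (card (periods \<inter> sball 0 (real N)))"

definition gap_volume :: "'d site \<Rightarrow> nat \<Rightarrow> real" where
  "gap_volume i N = (\<Sum>k\<in>sball i (real N). w k - z k)"

text \<open>At site 0 the four numbers are coordinates of translates of \<open>z\<close> and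
  \<open>w\<close>. A common point puts each translate of \<open>z\<close> below the other translate
  of \<open>w\<close>; neither is strictly between, so the two translates of \<open>z\<close>
  coincide.\<close>

lemma overlap_period:
  assumes "z i + real_of_int l \<le> p" "p < w i + real_of_int l"
    "z j + real_of_int m \<le> p" "p < w j + real_of_int m"
  shows "i - j \<in> periods"
proof -
  have \<Gamma>: "tau i l z \<in> \<Gamma>" "tau j m z \<in> \<Gamma>" "tau i l w \<in> \<Gamma>" "tau j m w \<in> \<Gamma>"
    using tau_in z_in w_in by auto
  have "strict_less (tau j m z) (tau i l w)" "strict_less (tau i l z) (tau j m w)"
    using less_iff_coord[OF \<Gamma>(2,3), of 0] less_iff_coord[OF \<Gamma>(1,4), of 0] assms
    by (simp_all add: tau_def)
  hence eq: "tau i l z = tau j m z"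
    using no_tau_between ordered[OF \<Gamma>(1,2)] by blast
  have "tau (i - j) (l - m) z = tau (- j) (- m) (tau i l z)"
    by (simp add: tau_tau)
  also have "\<dots> = z" by (simp add: eq)
  finally show ?thesis by (auto simp: periods_def)
qed

text \<open>Over site 0 the translates of \<open>[z, w]\<close> by non-congruent vectors are disjoint, so modulo
  integer shifts each point is covered at most \<open>period_count (2 * N)\<close> times.\<close>

lemma gap_volume_le: "gap_volume i N \<le> 2 * period_count (2 * N)"
proof -
  let ?X = "sball i (real N)" and ?P = "period_count (2 * N)"
  \<comment> \<open>Each interval is shifted to start in \<open>[0,1)\<close>; as its length is at
    most 1, all lie in \<open>[0,2]\<close>, whence the factor 2.\<close>
  define l where "l k = - \<lfloor>z k\<rfloor>" for k
  define I where "I k = {z k + real_of_int (l k)..<w k + real_of_int (l k)}" for k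
  have l: "0 \<le> z k + real_of_int (l k)" "z k + real_of_int (l k) < 1" for k
    unfolding l_def by simp_all linarith+
  have cover: "(\<Sum>k\<in>?X. indicator (I k) p) \<le> ?P * indicator {0..2} p" for p :: real
  proof -
    define J where "J = {k \<in> ?X. p \<in> I k}"
    have eq: "(\<Sum>k\<in>?X. indicator (I k) p) = real (card J)"
      by (simp add: J_def indicator_def sum.If_cases Int_def)
    show ?thesis
    proof (cases "J = {}")
      case True
      thus ?thesis unfolding eq by (simp add: period_count_def)
    next
      case False
      then obtain k0 where k0: "k0 \<in> J" by blast
      have p: "p \<in> {0..2}"
        using k0 l[of k0] gap_le_1[of k0] by (auto simp: J_def I_def)
      \<comment> \<open>Differences with one fixed member are periods, and two sites of a ball of
        radius \<open>N\<close> are at distance at most \<open>2 * N\<close>.\<close>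
      have "(\<lambda>k. k - k0) ` J \<subseteq> periods \<inter> sball 0 (real (2 * N))"
      proof (rule image_subsetI)
        fix k assume k: "k \<in> J"
        have "k - k0 \<in> periods"
          using k k0 by (intro overlap_period[of _ "l k" p _ "l k0"]) (auto simp: J_def I_def)
        moreover have "k \<in> sball k0 (real N + real N)"
          using k k0 sball_sym[of k0 i] by (intro sball_add[of i]) (auto simp: J_def)
        hence "k - k0 \<in> sball 0 (real (2 * N))" by (simp add: sball_def)
        ultimately show "k - k0 \<in> periods \<inter> sball 0 (real (2 * N))" by blast
      qed
      moreover have "inj_on (\<lambda>k. k - k0) J" by (simp add: inj_on_def)
      ultimately have "card J \<le> card (periods \<inter> sball 0 (real (2 * N)))"
        by (intro card_inj_on_le) auto
      thus ?thesis unfolding eq using p by (simp add: period_count_def)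
    qed
  qed
  have int: "integrable lborel (indicat_real (I k))" for k
    using z_less_w_coord[of k] by (intro integrable_real_indicator) (auto simp: I_def)
  have "gap_volume i N = (\<Sum>k\<in>?X. \<integral>p. indicator (I k) p \<partial>lborel)"
    unfolding gap_volume_def I_def using z_less_w_coord by (simp add: less_imp_le)
  also have "\<dots> = (\<integral>p. (\<Sum>k\<in>?X. indicator (I k) p) \<partial>lborel)"
    by (rule Bochner_Integration.integral_sum[symmetric]) (rule int)
  also have "\<dots> \<le> (\<integral>p. ?P * indicator {0..2 :: real} p \<partial>lborel)"
    by (rule integral_mono[OF _ _ cover]) (simp_all add: int)
  also have "\<dots> = 2 * ?P" by simp
  finally show ?thesis .
qed

section \<open>The sign of the actions and the contradiction\<close>

lemma gradW_leaf_one_signed_between: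
  assumes signed: "\<And>y. y \<in> \<Gamma> \<Longrightarrow> (\<forall>i. 0 \<le> gradW S r y i) \<or> (\<forall>i. gradW S r y i \<le> 0)"
  shows "(\<forall>s\<in>{z 0<..<w 0}. \<forall>i. 0 \<le> gradW S r (leaf 0 s) i) \<or>
         (\<forall>s\<in>{z 0<..<w 0}. \<forall>i. gradW S r (leaf 0 s) i \<le> 0)"
proof (rule ccontr)
  assume neg: "\<not> ?thesis"
  let ?A = "{s. \<forall>i. 0 \<le> gradW S r (leaf 0 s) i}" and ?B = "{s. \<forall>i. gradW S r (leaf 0 s) i \<le> 0}"
  have cont: "continuous_on UNIV (\<lambda>s. gradW S r (leaf 0 s) i)" for i
    by (rule continuous_on_compose2[OF continuous_gradW continuous_leaf]) auto
  have "closed ?A" "closed ?B"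
    by (intro closed_Collect_all closed_Collect_le cont continuous_on_const)+
  moreover have "{z 0<..<w 0} \<subseteq> ?A \<union> ?B" using signed[OF leaf_in] by blast
  moreover have "?A \<inter> {z 0<..<w 0} \<noteq> {}" "?B \<inter> {z 0<..<w 0} \<noteq> {}"
    using neg signed[OF leaf_in] by blast+
  \<comment> \<open>Where both signs hold the gradient vanishes, giving a stationary element inside
    the gap; so a change of sign would disconnect the interval.\<close>
  moreover have "?A \<inter> ?B \<inter> {z 0<..<w 0} = {}"
  proof -
    have "\<not> stationary S r (leaf 0 s)" if "s \<in> {z 0<..<w 0}" for s
      using that less_iff_coord[OF z_in leaf_in, of 0 s 0] less_iff_coord[OF leaf_in w_in, of 0 s 0]
      by (intro no_stationary_between) auto
    moreover have "stationary S r (leaf 0 s)" if "s \<in> ?A \<inter> ?B" for s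
      unfolding stationary_iff using that by (simp add: order.antisym)
    ultimately show ?thesis by blast
  qed
  ultimately show False
    using connected_Ioo[of "z 0" "w 0"] unfolding connected_closed by blast
qed

lemma action_one_signed:
  assumes signed: "\<And>y. y \<in> \<Gamma> \<Longrightarrow> (\<forall>i. 0 \<le> gradW S r y i) \<or> (\<forall>i. gradW S r y i \<le> 0)"
  obtains i \<sigma> where "action i \<noteq> 0" "\<bar>\<sigma>\<bar> = (1::real)" "\<And>k. \<bar>action k\<bar> = \<sigma> * action k"
proof -
  obtain \<sigma> :: real where \<sigma>: "\<bar>\<sigma>\<bar> = 1"
    and pos: "\<And>s i. \<lbrakk>z 0 < s; s < w 0\<rbrakk> \<Longrightarrow> 0 \<le> \<sigma> * gradW S r (leaf 0 s) i"
  proof -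
    consider "\<forall>s\<in>{z 0<..<w 0}. \<forall>i. 0 \<le> gradW S r (leaf 0 s) i"
      | "\<forall>s\<in>{z 0<..<w 0}. \<forall>i. gradW S r (leaf 0 s) i \<le> 0"
      using gradW_leaf_one_signed_between[OF signed] by blast
    thus ?thesis
    proof cases
      case 1 thus ?thesis by (intro that[of 1]) auto
    next
      case 2 thus ?thesis by (intro that[of "-1"]) auto
    qed
  qed
  have nonneg: "0 \<le> \<sigma> * grad_leaf k \<xi>" if "\<xi> \<in> {z k..w k}" for k \<xi>
  proof -
    have eq: "leaf k \<xi> = leaf 0 (leaf k \<xi> 0)" by (simp add: leaf_eq)
    have "z 0 \<le> leaf k \<xi> 0" "leaf k \<xi> 0 \<le> w 0"
      using that coord_le_iff[OF z_in leaf_in, of 0 k \<xi> k] coord_le_iff[OF leaf_in w_in, of k \<xi> 0 k]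
      by auto
    then consider "leaf k \<xi> 0 = z 0" | "leaf k \<xi> 0 = w 0" | "z 0 < leaf k \<xi> 0" "leaf k \<xi> 0 < w 0"
      by linarith
    thus ?thesis
    proof cases
      case 1
      hence "leaf k \<xi> = z" using eq_iff_coord[OF leaf_in z_in] by blast
      thus ?thesis using z_stationary by (simp add: grad_leaf_def stationary_iff)
    next
      case 2
      hence "leaf k \<xi> = w" using eq_iff_coord[OF leaf_in w_in] by blast
      thus ?thesis using w_stationary by (simp add: grad_leaf_def stationary_iff)
    next
      case 3
      thus ?thesis using pos[of "leaf k \<xi> 0" k] eq by (simp add: grad_leaf_def)
    qed
  qed
  have sigma_action: "integral {z k..w k} (\<lambda>\<xi>. \<sigma> * grad_leaf k \<xi>) = \<sigma> * action k" for k
    by (simp add: action_def)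
  have "0 \<le> \<sigma> * action k" for k
    unfolding sigma_action[symmetric]
    by (intro integral_nonneg nonneg integrable_on_mult_right grad_leaf_integrable)
  hence "\<bar>action k\<bar> = \<sigma> * action k" for k
    using \<sigma> by (metis abs_mult abs_of_nonneg mult_1)
  moreover
  \<comment> \<open>An element strictly inside the gap is not stationary, so some gradient entry is
    nonzero; by continuity and constant sign the integral at that site does not vanish.\<close>
  let ?y = "leaf 0 ((z 0 + w 0) / 2)"
  have between: "strict_less z ?y" "strict_less ?y w"
    using less_iff_coord[OF z_in leaf_in, of 0 _ 0] less_iff_coord[OF leaf_in w_in, of 0 _ 0]
      z_less_w_coord[of 0] by auto
  then obtain i where i: "gradW S r ?y i \<noteq> 0"
    using no_stationary_between[OF leaf_in] unfolding stationary_iff by blast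
  have y: "?y i \<in> {z i..w i}" using between by (simp add: strict_less_def less_imp_le)
  have "action i \<noteq> 0"
  proof
    assume "action i = 0"
    hence "integral {z i..w i} (\<lambda>\<xi>. \<sigma> * grad_leaf i \<xi>) = 0"
      unfolding sigma_action by simp
    moreover have "continuous_on {z i..w i} (\<lambda>\<xi>. \<sigma> * grad_leaf i \<xi>)"
      by (intro continuous_intros continuous_on_subset[OF continuous_grad_leaf]) auto
    ultimately have "\<sigma> * grad_leaf i (?y i) = 0"
      using y nonneg integral_eq_0_iff[OF _ z_less_w_coord] by blast
    thus False using i \<sigma> by (auto simp: grad_leaf_def leaf_eq)
  qed
  ultimately show ?thesis using that \<sigma> by blast
qed

lemma gap_contradiction:
  assumes signed: "\<And>y. y \<in> \<Gamma> \<Longrightarrow> (\<forall>i. 0 \<le> gradW S r y i) \<or> (\<forall>i. gradW S r y i \<le> 0)"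
    and min: "global_minimizer S r z" "global_minimizer S r w"
  shows False
proof -
  obtain i \<sigma> where i: "action i \<noteq> 0" and \<sigma>: "\<bar>\<sigma>\<bar> = (1::real)"
    and abs_action: "\<And>k. \<bar>action k\<bar> = \<sigma> * action k"
    using action_one_signed[OF signed] by blast
  define R where "R = nat \<lceil>r\<rceil>"
  have R: "r \<le> real R" "0 < R" using r_pos unfolding R_def by linarith+
  show False
  proof (rule growth_contradiction[where P = period_count and A = "gap_volume i"
        and c = "\<bar>action i\<bar>" and D = "2 * nb * G" and H = "2 * R" and d = "CARD('d)"])
    fix M
    \<comment> \<open>As \<open>r \<le> real R\<close>, the inner part contains the ball of radius
      \<open>M\<close> and the reach stays within radius \<open>M + 2 * R\<close>: the boundary lies
      in a shell of width \<open>2 * R\<close>.\<close>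
    let ?B = "sball i (real (M + R))" and ?in = "sball i (real M)" and ?out = "sball i (real (M + 2 * R))"
    have inner: "?in \<subseteq> inner_part ?B r"
    proof
      fix k assume "k \<in> ?in"
      hence "sball k (real R) \<subseteq> ?B" using sball_add by fastforce
      hence "sball k r \<subseteq> ?B" using sball_mono[OF R(1)] by blast
      thus "k \<in> inner_part ?B r" unfolding inner_part_def using center_in_sball by blast
    qed
    have "reach ?B \<subseteq> ?out"
    proof
      fix k assume "k \<in> reach ?B"
      then obtain j where j: "j \<in> ?B" "k \<in> sball j r" by (auto simp: reach_def)
      hence "k \<in> sball j (real R)" using sball_mono[OF R(1)] by blast
      from sball_add[OF j(1) this] show "k \<in> ?out" by (simp add: ac_simps)
    qed
    hence shell: "reach ?B - inner_part ?B r \<subseteq> ?out - ?in" using inner by blast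
    have "?in \<subseteq> ?out" by (rule sball_mono) simp
    hence vol: "gap_volume i (M + 2 * R) - gap_volume i M = (\<Sum>k\<in>?out - ?in. w k - z k)"
      unfolding gap_volume_def by (subst sum_diff) auto
    have "(\<Sum>k\<in>reach ?B - inner_part ?B r. w k - z k) \<le> (\<Sum>k\<in>?out - ?in. w k - z k)"
      by (rule sum_mono2[OF _ shell]) (auto simp: z_less_w_coord less_imp_le)
    hence "2 * nb * G * (\<Sum>k\<in>reach ?B - inner_part ?B r. w k - z k)
        \<le> 2 * nb * G * (gap_volume i (M + 2 * R) - gap_volume i M)"
      unfolding vol using nb_nonneg G_nonneg by (intro mult_left_mono) auto
    moreover have "\<bar>action i\<bar> * period_count M \<le> \<bar>\<Sum>k\<in>inner_part ?B r. action k\<bar>"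
    proof -
      \<comment> \<open>The translates of \<open>i\<close> by periods all carry the same action, and
        constant sign prevents cancellation with the remaining inner sites.\<close>
      let ?K = "(\<lambda>k. i + k) ` (periods \<inter> sball 0 (real M))"
      have "i + k \<in> ?in" if "k \<in> sball 0 (real M)" for k
        using that sball_shift[of k i 0] by (simp add: add.commute)
      hence K: "?K \<subseteq> inner_part ?B r" using inner by blast
      have "\<bar>action (i + k)\<bar> = \<bar>action i\<bar>" if "k \<in> periods" for k
        using that action_period by (auto simp: periods_def)
      hence "\<bar>action i\<bar> * period_count M
          = (\<Sum>k\<in>periods \<inter> sball 0 (real M). \<bar>action (i + k)\<bar>)"
        by (simp add: period_count_def mult.commute)
      also have "\<dots> = (\<Sum>k\<in>?K. \<bar>action k\<bar>)"
        by (subst sum.reindex) (auto simp: inj_on_def)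
      also have "\<dots> \<le> (\<Sum>k\<in>inner_part ?B r. \<bar>action k\<bar>)"
        by (rule sum_mono2[OF _ K]) (auto simp: inner_part_def)
      also have "\<dots> = \<sigma> * (\<Sum>k\<in>inner_part ?B r. action k)"
        by (simp add: abs_action sum_distrib_left)
      also have "\<dots> \<le> \<bar>\<Sum>k\<in>inner_part ?B r. action k\<bar>"
        using \<sigma> by (metis abs_ge_self abs_mult mult_1)
      finally show ?thesis .
    qed
    moreover have "\<bar>\<Sum>k\<in>inner_part ?B r. action k\<bar>
        \<le> 2 * nb * G * (\<Sum>k\<in>reach ?B - inner_part ?B r. w k - z k)"
      by (rule action_sum_le[OF _ min]) simp
    ultimately show "\<bar>action i\<bar> * period_count M
        \<le> 2 * nb * G * (gap_volume i (M + 2 * R) - gap_volume i M)"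
      by linarith
  next
    show "mono period_count"
      unfolding period_count_def
      by (intro monoI of_nat_mono card_mono) (use sball_mono[of "real _" "real _" 0] in auto)
  next
    fix N
    have "(0 :: 'd site) \<in> periods" using tau_zero by (auto simp: periods_def intro: exI[of _ 0])
    hence "{0} \<subseteq> periods \<inter> sball 0 (real N)" by (simp add: sball_center)
    hence "card {0 :: 'd site} \<le> card (periods \<inter> sball 0 (real N))"
      by (intro card_mono) auto
    thus "1 \<le> period_count N" by (simp add: period_count_def)
    have "card (periods \<inter> sball 0 (real N)) \<le> card (sball (0 :: 'd site) (real N))"
      by (intro card_mono) auto
    also have "\<dots> \<le> (2 * N + 1) ^ CARD('d)" by (rule card_sball_le)
    finally show "period_count N \<le> real (2 * N + 1) ^ CARD('d)"
      unfolding period_count_def of_nat_power[symmetric] of_nat_le_iff .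
    show "gap_volume i N \<le> 2 * period_count (2 * N)" by (rule gap_volume_le)
    show "0 \<le> gap_volume i N"
      unfolding gap_volume_def using z_less_w_coord by (intro sum_nonneg) (simp add: less_imp_le)
  next
    show "0 < \<bar>action i\<bar>" "0 \<le> 2 * nb * G" "0 < 2 * R"
      using i nb_nonneg G_nonneg R by simp_all
  qed
qed

end

section \<open>From an arbitrary non-minimizer to a stationary one\<close>

context circle_in_potential
begin

lemma stationary_non_minimizer_exists:
  assumes signed: "\<And>y. y \<in> \<Gamma> \<Longrightarrow> (\<forall>i. 0 \<le> gradW S r y i) \<or> (\<forall>i. gradW S r y i \<le> 0)"
    and a: "a \<in> \<Gamma>" "stationary S r a" and b: "b \<in> \<Gamma>" "stationary S r b"
    and y: "y \<in> \<Gamma>" "a \<le> y" "y \<le> b" "\<not> global_minimizer S r y"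
  shows "\<exists>x\<in>\<Gamma> \<inter> ord_interval a b. stationary S r x \<and> \<not> global_minimizer S r x"
proof (rule ccontr)
  assume neg: "\<not> ?thesis"
  hence all_min: "global_minimizer S r x" if "x \<in> \<Gamma>" "a \<le> x" "x \<le> b" "stationary S r x" for x
    using that by (auto simp: ord_interval_def)
  have y_not: "\<not> stationary S r y" using all_min y by blast
  let ?T = "{s. stationary S r (leaf 0 s)}"
  have T: "closed ?T"
  proof -
    have "closed (leaf 0 -` {x. stationary S r x})"
      by (rule closed_vimage[OF closed_stationary continuous_leaf])
    thus ?thesis by (simp add: vimage_def)
  qed
  have le0: "a 0 \<le> y 0" "y 0 \<le> b 0" using y(2,3) by (simp_all add: le_fun_def)
  have compact: "compact (?T \<inter> {c..d})" for c d :: real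
    by (rule closed_Int_compact[OF T compact_Icc])
  have "a 0 \<in> ?T \<inter> {a 0..y 0}" "b 0 \<in> ?T \<inter> {y 0..b 0}"
    using leaf_eq[OF a(1)] leaf_eq[OF b(1)] a(2) b(2) le0 by simp_all
  hence nonempty: "?T \<inter> {a 0..y 0} \<noteq> {}" "?T \<inter> {y 0..b 0} \<noteq> {}" by blast+
  \<comment> \<open>The stationary parameters nearest to \<open>y\<close> on either side; they exist
    because the stationary parameters form a closed set and the ends \<open>a\<close> and
    \<open>b\<close> are stationary. Under the negated claim both are minimizers.\<close>
  obtain s where s: "s \<in> ?T \<inter> {a 0..y 0}" "\<And>t. t \<in> ?T \<inter> {a 0..y 0} \<Longrightarrow> t \<le> s"
    using compact_attains_sup[OF compact nonempty(1)] by blast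
  obtain t where t: "t \<in> ?T \<inter> {y 0..b 0}" "\<And>u. u \<in> ?T \<inter> {y 0..b 0} \<Longrightarrow> t \<le> u"
    using compact_attains_inf[OF compact nonempty(2)] by blast
  have ne: "s \<noteq> y 0" "t \<noteq> y 0" using s(1) t(1) y_not leaf_eq[OF y(1), of 0] by auto
  have interval: "a \<le> leaf 0 u \<and> leaf 0 u \<le> b" if "a 0 \<le> u" "u \<le> b 0" for u
    using coord_le_iff[OF a(1) leaf_in, of _ 0 u 0] coord_le_iff[OF leaf_in b(1), of 0 u _ 0] that
    by (simp add: le_fun_def)
  interpret gap: circle_gap S r \<Gamma> "leaf 0 s" "leaf 0 t"
  proof
    show "strict_less (leaf 0 s) (leaf 0 t)"
      using leaf_less_iff[of 0 s _ t] s(1) t(1) ne by (auto simp: strict_less_def)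
    fix x assume x: "x \<in> \<Gamma>" "strict_less (leaf 0 s) x" "strict_less x (leaf 0 t)"
    have x0: "s < x 0" "x 0 < t"
      using x(2,3) leaf_coord[of 0] unfolding strict_less_def by metis+
    show "\<not> stationary S r x"
    proof
      assume "stationary S r x"
      hence "x 0 \<in> ?T" using leaf_eq[OF x(1)] by simp
      thus False using s t x0 by (cases "x 0 \<le> y 0") force+
    qed
  qed (use s(1) t(1) in auto)
  show False
  proof (rule gap.gap_contradiction[OF signed])
    show "global_minimizer S r (leaf 0 s)" "global_minimizer S r (leaf 0 t)"
      using interval[of s] interval[of t] s(1) t(1) le0 by (auto intro!: all_min)
  qed
qed

end

theorem mainTheorem20:
  fixes S :: "'d::finite site \<Rightarrow> 'd config \<Rightarrow> real"
    and r :: real and \<omega> :: "'d \<Rightarrow> real"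
    and \<Psi> :: "real \<Rightarrow> 'd config \<Rightarrow> 'd config"
    and x ym yp :: "'d config" and \<Gamma> :: "'d config set"
  assumes "local_potentials S r"
    and "is_flow S r \<Psi>"
    and "x \<in> Bbar \<omega>"
    and "global_minimizer S r x"
    and "is_gap (aubry_mather \<omega> x) ym yp"
    and "ghost_circle \<Psi> \<Gamma>"
    and "aubry_mather \<omega> x \<subseteq> \<Gamma>"
  shows "(\<forall>y\<in>\<Gamma> \<inter> ord_interval ym yp. global_minimizer S r y) \<or>
         (\<exists>y\<in>\<Gamma> \<inter> ord_interval ym yp. stationary S r y \<and> \<not> global_minimizer S r y)"
proof -
  interpret circle_in_potential S r \<Gamma>
  proof
    show "local_potentials S r" by (rule assms(1))
    show "\<Gamma> \<noteq> {}" "connected \<Gamma>"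
      using assms(6) by (simp_all add: ghost_circle_def)
    show "strict_less x y \<or> x = y \<or> strict_less y x" if "x \<in> \<Gamma>" "y \<in> \<Gamma>" for x y
      using assms(6) that by (simp add: ghost_circle_def)
    show "tau k l x \<in> \<Gamma>" if "x \<in> \<Gamma>" for x k l
      using assms(6) that unfolding ghost_circle_def by blast
  qed
  have signed: "(\<forall>i. 0 \<le> gradW S r y i) \<or> (\<forall>i. gradW S r y i \<le> 0)" if "y \<in> \<Gamma>" for y
  proof (rule gradW_one_signed[OF assms(2) _ _ that])
    show "inX x" if "x \<in> \<Gamma>" for x
      using assms(6) that by (simp add: ghost_circle_def)
    show "\<Psi> t x \<in> \<Gamma>" if "x \<in> \<Gamma>" for x t
      using assms(6) that unfolding ghost_circle_def by blast
  qed
  \<comment> \<open>The ends of the gap belong to the Aubry-Mather set, hence are global minimizers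
    and so stationary.\<close>
  have ends: "ym \<in> \<Gamma>" "yp \<in> \<Gamma>" "stationary S r ym" "stationary S r yp"
    using assms(5,7) aubry_mather_global_minimizer[OF assms(4)] global_minimizer_stationary
    by (auto simp: is_gap_def)
  show ?thesis
    using stationary_non_minimizer_exists[OF signed ends(1,3,2,4)] unfolding ord_interval_def by blast
qed

end
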